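(* Let $X$ be a finite connected graph such that $\chi(X)\ne0$, and fix a voltage assignment $\alpha\colon\mathbf{E}_X\to\mathbb{Z}$ such that $X(\mathbb{Z},\alpha)$ is connected. For $n\in\mathbb{N}$ let $X_n := X(\mathbb{Z}/n\mathbb{Z},\pi_n\circ\alpha)$, where $\pi_n\colon\mathbb{Z}\to\mathbb{Z}/n\mathbb{Z}$ is the quotient map. Let $\mathcal{I}_\alpha$ be the Ihara polynomial of $\alpha$, $b := -\mathrm{ord}_{t=0}(\mathcal{I}_\alpha)$, $I_\alpha(t) := t^b\mathcal{I}_\alpha(t)\in\mathbb{Z}[t]$, $e := \mathrm{ord}_{t=1}(I_\alpha)$, and let $J_\alpha\in\mathbb{Z}[t]$ be defined by $I_\alpha(t)=(t-1)^eJ_\alpha(t)$. If $J_\alpha$ does not have any root on the unit circle of $\mathbb{C}$, then $$\kappa(X_n)\sim n^{e-1}\,\frac{\kappa(X)}{|\Delta_1(J_\alpha)|}\,M_\infty(I_\alpha)^n$$ as $n\to+\infty$.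
   Context: $\mathbb{N}=\{1,2,\dots\}$, and $\sim$ means that the ratio of the two sides tends to $1$. Graphs are in the sense of Serre: a graph $X$ consists of a set $V_X$ of vertices, a set $\mathbf{E}_X$ of directed edges, origin and terminus maps $o,t\colon\mathbf{E}_X\to V_X$, and an inversion $e\mapsto\bar e$ on $\mathbf{E}_X$ with $o(\bar e)=t(e)$, $t(\bar e)=o(e)$ and $\bar{\bar e}=e\ne\bar e$. Loops and multiple edges are allowed. $X$ is finite if $V_X$ and $\mathbf{E}_X$ are finite, and connected if any two vertices are joined by a path of directed edges. $\chi(X)=|V_X|-|\mathbf{E}_X|/2$, and $\kappa(X)$ is the number of spanning trees of a finite graph $X$. A voltage assignment with values in a group $G$ is a function $\alpha\colon\mathbf{E}_X\to G$ with $\alpha(\bar e)=\alpha(e)^{-1}$ for all $e$. The graph $X(G,\alpha)$ has vertex set $V_X\times G$, edge set $\mathbf{E}_X\times G$, and $o(e,\sigma)=(o(e),\sigma)$, $t(e,\sigma)=(t(e),\sigma\cdot\alpha(e))$, $\overline{(e,\sigma)}=(\bar e,\sigma\cdot\alpha(e))$. Ihara polynomial of $\alpha\colon\mathbf{E}_X\to\mathbb{Z}$: order $V_X=\{v_1,\dots,v_g\}$, let $D_X$ be the diagonal matrix with entries $\#\{e\in\mathbf{E}_X: o(e)=v_i\}$, and let $A_\alpha(t)$ be the $g\times g$ matrix with $(i,j)$ entry $\sum_{e:\,o(e)=v_i,\,t(e)=v_j}t^{\alpha(e)}$; then $\mathcal{I}_\alpha(t)=\det(D_X-A_\alpha(t))\in\mathbb{Z}[t^{\pm1}]$.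 $\mathrm{ord}_{t=a}$ denotes the order of vanishing at $t=a$. For $f(t)=a_d\prod_{i=1}^d(t-\alpha_i)\in\mathbb{Z}[t]$ with $a_d\ne0$ and $\alpha_i\in\mathbb{C}$: $\Delta_n(f)=a_d^n\prod_{i=1}^d(\alpha_i^n-1)\in\mathbb{Z}$ is the Pierce-Lehmer sequence, and $M_\infty(f)=|a_d|\prod_{i=1}^d\max\{1,|\alpha_i|\}$ is the Archimedean Mahler measure. *)

theory Defs
  imports
    "Graph_Theory.Graph_Theory"
    "HOL-Algebra.Elementary_Groups"
    "HOL-Computational_Algebra.Formal_Laurent_Series"
    "HOL-Computational_Algebra.Polynomial_FPS"
    "HOL-Library.Landau_Symbols"
    "Jordan_Normal_Form.Determinant"
    "Berlekamp_Zassenhaus.Mahler_Measure"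
begin

text \<open>
  A graph in the sense of Serre is a pair \<open>X\<close>, \<open>arev\<close> with \<^prop>\<open>bidirected_digraph X arev\<close>:
  \<open>arcs X\<close> is the set of directed edges, \<open>tail X\<close> and \<open>head X\<close> are the origin and terminus maps,
  and \<open>arev\<close> is the inversion. The locale stipulates that \<open>arev\<close> is the identity off \<open>arcs X\<close>; this
  is only a normal form for the junk values. Connectedness (any two vertices are joined by a path
  of directed edges) is \<^const>\<open>strongly_connected\<close>; it also requires a vertex.
\<close>

definition euler_char :: "('v, 'e) pre_digraph \<Rightarrow> real" where
  "euler_char X = real (card (verts X)) - real (card (arcs X)) / 2"


text \<open>
  \<^const>\<open>pre_digraph.cycle\<close> is the notion for digraphs, for which \<open>[e, arev e]\<close> is a cycle. The
  circuits of a Serre graph are the cycles without backtracking, including at the base point. Loops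
  are circuits of length 1, and two distinct geometric edges with the same end points give a
  circuit of length 2.
\<close>

definition circuit :: "('v, 'e) pre_digraph \<Rightarrow> ('e \<Rightarrow> 'e) \<Rightarrow> 'e list \<Rightarrow> bool" where
  "circuit X arev p \<longleftrightarrow> pre_digraph.cycle X p \<and>
     (\<forall>i < length p. p ! (Suc i mod length p) \<noteq> arev (p ! i))"

definition serre_tree :: "('v, 'e) pre_digraph \<Rightarrow> ('e \<Rightarrow> 'e) \<Rightarrow> bool" where
  "serre_tree T arev \<longleftrightarrow> strongly_connected T \<and> \<not> (\<exists>p. circuit T arev p)"

definition serre_spanning_tree ::
    "('v, 'e) pre_digraph \<Rightarrow> ('v, 'e) pre_digraph \<Rightarrow> ('e \<Rightarrow> 'e) \<Rightarrow> bool" where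
  "serre_spanning_tree T X arev \<longleftrightarrow>
     spanning T X \<and> (\<forall>e \<in> arcs T. arev e \<in> arcs T) \<and> serre_tree T arev"

definition num_spanning_trees :: "('v, 'e) pre_digraph \<Rightarrow> ('e \<Rightarrow> 'e) \<Rightarrow> nat" where
  "num_spanning_trees X arev = card {T. serre_spanning_tree T X arev}"


definition voltage_assignment ::
    "('g, 'z) monoid_scheme \<Rightarrow> ('v, 'e) pre_digraph \<Rightarrow> ('e \<Rightarrow> 'e) \<Rightarrow> ('e \<Rightarrow> 'g) \<Rightarrow> bool" where
  "voltage_assignment G X arev \<alpha> \<longleftrightarrow>
     (\<forall>e \<in> arcs X. \<alpha> e \<in> carrier G \<and> \<alpha> (arev e) = inv\<^bsub>G\<^esub> (\<alpha> e))"

definition derived_graph ::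
    "('g, 'z) monoid_scheme \<Rightarrow> ('v, 'e) pre_digraph \<Rightarrow> ('e \<Rightarrow> 'g) \<Rightarrow> ('v \<times> 'g, 'e \<times> 'g) pre_digraph" where
  "derived_graph G X \<alpha> =
     \<lparr> verts = verts X \<times> carrier G,
       arcs = arcs X \<times> carrier G,
       tail = (\<lambda>(e, \<sigma>). (tail X e, \<sigma>)),
       head = (\<lambda>(e, \<sigma>). (head X e, \<sigma> \<otimes>\<^bsub>G\<^esub> \<alpha> e)) \<rparr>"

definition derived_arev ::
    "('g, 'z) monoid_scheme \<Rightarrow> ('v, 'e) pre_digraph \<Rightarrow> ('e \<Rightarrow> 'e) \<Rightarrow> ('e \<Rightarrow> 'g)
      \<Rightarrow> 'e \<times> 'g \<Rightarrow> 'e \<times> 'g" where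
  "derived_arev G X arev \<alpha> = (\<lambda>(e, \<sigma>).
     if (e, \<sigma>) \<in> arcs X \<times> carrier G then (arev e, \<sigma> \<otimes>\<^bsub>G\<^esub> \<alpha> e) else (e, \<sigma>))"

lemma bidirected_digraph_derived_graph:
  assumes "bidirected_digraph X arev" "group G" "voltage_assignment G X arev \<alpha>"
  shows "bidirected_digraph (derived_graph G X \<alpha>) (derived_arev G X arev \<alpha>)"
proof -
  interpret X: bidirected_digraph X arev by fact
  interpret G: group G by fact
  have \<alpha>: "\<alpha> e \<in> carrier G" "\<alpha> (arev e) = inv\<^bsub>G\<^esub> (\<alpha> e)" if "e \<in> arcs X" for e
    using assms(3) that by (auto simp: voltage_assignment_def)
  show ?thesis
    by unfold_locales
      (auto simp: derived_graph_def derived_arev_def \<alpha> G.m_assoc X.arev_neq split: if_splits)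
qed


text \<open>
  The ring \<open>\<int>[t\<^sup>\<plusminus>\<^sup>1]\<close> is realised inside the formal Laurent series, where the order of
  vanishing at \<open>t = 0\<close> is \<^const>\<open>fls_subdegree\<close>. The list \<open>vs\<close> is the chosen ordering of the
  vertices.
\<close>

definition degree_matrix :: "'v list \<Rightarrow> ('v, 'e) pre_digraph \<Rightarrow> int fls mat" where
  "degree_matrix vs X = mat (length vs) (length vs) (\<lambda>(i, j).
     if i = j then of_nat (card {e \<in> arcs X. tail X e = vs ! i}) else 0)"

definition voltage_adjacency_matrix ::
    "'v list \<Rightarrow> ('v, 'e) pre_digraph \<Rightarrow> ('e \<Rightarrow> int) \<Rightarrow> int fls mat" where
  "voltage_adjacency_matrix vs X \<alpha> = mat (length vs) (length vs) (\<lambda>(i, j).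
     \<Sum>e \<in> {e \<in> arcs X. tail X e = vs ! i \<and> head X e = vs ! j}. fls_X_intpow (\<alpha> e))"

definition Ihara :: "'v list \<Rightarrow> ('v, 'e) pre_digraph \<Rightarrow> ('e \<Rightarrow> int) \<Rightarrow> int fls" where
  "Ihara vs X \<alpha> = Determinant.det (degree_matrix vs X - voltage_adjacency_matrix vs X \<alpha>)"

definition Ihara_poly :: "'v list \<Rightarrow> ('v, 'e) pre_digraph \<Rightarrow> ('e \<Rightarrow> int) \<Rightarrow> int poly" where
  "Ihara_poly vs X \<alpha> =
     (let b = - fls_subdegree (Ihara vs X \<alpha>)
      in THE I. fps_to_fls (fps_of_poly I) = fls_X_intpow b * Ihara vs X \<alpha>)"

definition Ihara_order :: "'v list \<Rightarrow> ('v, 'e) pre_digraph \<Rightarrow> ('e \<Rightarrow> int) \<Rightarrow> nat" where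
  "Ihara_order vs X \<alpha> = Polynomial.order 1 (Ihara_poly vs X \<alpha>)"

definition Ihara_cofactor :: "'v list \<Rightarrow> ('v, 'e) pre_digraph \<Rightarrow> ('e \<Rightarrow> int) \<Rightarrow> int poly" where
  "Ihara_cofactor vs X \<alpha> =
     (THE J. Ihara_poly vs X \<alpha> = [:-1, 1:] ^ Ihara_order vs X \<alpha> * J)"


text \<open>
  The roots are listed with multiplicity. The values are integers, but they are kept in \<open>\<complex>\<close>.
  The Mahler measure is \<^const>\<open>mahler_measure\<close>.
\<close>

definition pierce_lehmer :: "int poly \<Rightarrow> nat \<Rightarrow> complex" where
  "pierce_lehmer f n =
     of_int (lead_coeff f) ^ n * (\<Prod>a \<leftarrow> complex_roots_int f. (a ^ n - 1))"

end

theory Submission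
  imports Defs
begin

text \<open>
  Everything follows from the identity
  \<open>n * \<kappa>(X\<^sub>n) = \<kappa>(X) * (\<Prod>\<zeta>. det (D - A\<^sub>\<alpha>(\<zeta>)))\<close>, where \<open>\<zeta>\<close> runs over the \<open>n\<close>-th roots of unity other
  than 1. By the matrix tree theorem, \<open>det (L + s) = s * N\<^sup>2 * \<kappa>\<close> for the Laplacian \<open>L\<close> of a graph with
  \<open>N\<close> vertices and a constant \<open>s\<close> added to all entries. For \<open>X\<^sub>n\<close> and \<open>s = 1\<close> this matrix is block
  circulant, so the discrete Fourier transform splits it into the blocks \<open>D - A\<^sub>\<alpha>(\<zeta>)\<close>, the block of
  \<open>\<zeta> = 1\<close> being the Laplacian of \<open>X\<close> with \<open>n\<close> added to all entries. On the unit circle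
  \<open>det (D - A\<^sub>\<alpha>(\<zeta>))\<close> and \<open>(\<zeta> - 1)\<^sup>e * J\<^sub>\<alpha>(\<zeta>)\<close> have the same modulus; the product of the first factors is
  \<open>n\<^sup>e\<close> in modulus, that of the second ones is \<open>\<Delta>\<^sub>n(J\<^sub>\<alpha>) / \<Delta>\<^sub>1(J\<^sub>\<alpha>)\<close>.
\<close>

text \<open>The Laplacian is singular, and the usual remedy of deleting a row and a column would
  destroy the block circulant shape of the cover. Adding a constant keeps it: a vector that is
  constant along the sheets is seen only by \<zeta> = 1, so the other blocks do not change. With g
  the number of vertices of X, the comparison reads n^2 g^2 \<kappa>(X_n) = n g^2 \<kappa>(X) times
  the product over \<zeta>; the surviving factor n is the -1 in the exponent e - 1. The division by
  \<Delta>_1(J), which is J(1) up to sign, accounts for the factor missing at \<zeta> = 1. The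
  hypothesis on the roots gives J(1) \<noteq> 0 and makes |a^n - 1| asymptotic to max(1, |a|)^n for
  every root a. The matrix tree theorem is obtained by expanding the reduced determinant over the
  choices of one outgoing arc at each vertex other than the root, which treats loops and multiple
  edges uniformly. What then remains is to match these choices with trees in the sense of Serre,
  where an edge is a pair of inverse arcs and a circuit must not backtrack.\<close>

subsection \<open>The reduced Laplacian determinant\<close>

text \<open>
  The matrix is the identity minus the functional digraph of \<open>h\<close> with the arc leaving \<open>r\<close> removed. A
  strictly decreasing rank function exists iff iterating \<open>h\<close> leads from every index to \<open>r\<close>.
  With a rank function only the identity contributes to the Leibniz formula; without one, the
  indicator vector of the indices that never reach \<open>r\<close> lies in the kernel.
\<close>

lemma det_functional_matrix:
  fixes h :: "nat \<Rightarrow> nat"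
  assumes h: "\<And>i. i < n \<Longrightarrow> h i < n" and r: "r < n"
  shows "Determinant.det (mat n n (\<lambda>(i, j).
           of_bool (i = j) - of_bool (i \<noteq> r \<and> h i = j)) :: 'a :: idom mat) =
         of_bool (\<exists>d :: nat \<Rightarrow> nat. \<forall>i<n. i \<noteq> r \<longrightarrow> d (h i) < d i)"
proof (cases "\<exists>d :: nat \<Rightarrow> nat. \<forall>i<n. i \<noteq> r \<longrightarrow> d (h i) < d i")
  case True
  then obtain d :: "nat \<Rightarrow> nat" where d: "\<And>i. i < n \<Longrightarrow> i \<noteq> r \<Longrightarrow> d (h i) < d i" by blast
  define M where "M = (mat n n (\<lambda>(i, j). of_bool (i = j) - of_bool (i \<noteq> r \<and> h i = j)) :: 'a mat)"
  have M: "M \<in> carrier_mat n n" by (simp add: M_def)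
  have zero: "(\<Prod>i = 0..<n. M $$ (i, p i)) = 0" if p: "p permutes {0..<n}" "p \<noteq> id" for p
  proof (rule ccontr)
    assume *: "(\<Prod>i = 0..<n. M $$ (i, p i)) \<noteq> 0"
    have pn: "p i < n" if "i < n" for i using permutes_in_image[OF p(1), of i] that by auto
    have moved: "h i = p i \<and> i \<noteq> r" if "i < n" "p i \<noteq> i" for i
    proof -
      have "M $$ (i, p i) \<noteq> 0" using * that by (simp add: prod_zero_iff)
      then show ?thesis using that pn[of i] by (auto simp: M_def split: if_splits)
    qed
    obtain k where k: "p k \<noteq> k" using p(2) by (auto simp: fun_eq_iff)
    with p(1) have kn: "k < n" by (metis atLeastLessThan_iff permutes_not_in zero_le)
    \<comment> \<open>A permutation leaves the sum of the ranks unchanged, whereas every moved index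
      follows \<open>h\<close> and so lowers it.\<close>
    have "(\<Sum>i\<in>{0..<n}. d (p i)) < (\<Sum>i\<in>{0..<n}. d i)"
    proof (rule sum_strict_mono_ex1)
      show "\<forall>i\<in>{0..<n}. d (p i) \<le> d i"
        using d moved by (metis atLeastLessThan_iff order.strict_implies_order order_refl)
      show "\<exists>i\<in>{0..<n}. d (p i) < d i"
        using kn k d[of k] moved[of k] by auto
    qed auto
    moreover have "(\<Sum>i\<in>{0..<n}. d (p i)) = (\<Sum>i\<in>{0..<n}. d i)"
      using sum.permute[OF p(1), of d] by (simp add: o_def)
    ultimately show False by simp
  qed
  have "Determinant.det M = (\<Sum>p\<in>{p. p permutes {0..<n}}. signof p * (\<Prod>i = 0..<n. M $$ (i, p i)))"
    by (rule det_def'[OF M])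
  also have "\<dots> = (\<Sum>p\<in>{id}. signof p * (\<Prod>i = 0..<n. M $$ (i, p i)))"
    by (rule sum.mono_neutral_right) (auto simp: finite_permutations permutes_id zero)
  also have "\<dots> = 1"
  proof -
    \<comment> \<open>The rank function excludes fixed points of \<open>h\<close> other than
      \<open>r\<close>, so nothing is subtracted on the diagonal.\<close>
    have "M $$ (i, i) = 1" if "i < n" for i using that d[of i] by (auto simp: M_def)
    then show ?thesis by simp
  qed
  finally show ?thesis using True by (simp add: M_def)
next
  case False
  define M where "M = (mat n n (\<lambda>(i, j). of_bool (i = j) - of_bool (i \<noteq> r \<and> h i = j)) :: 'a mat)"
  have M: "M \<in> carrier_mat n n" by (simp add: M_def)
  \<comment> \<open>Making \<open>r\<close> absorbing turns "never reaches \<open>r\<close>" into a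
    condition on plain iterates; \<open>S\<close> is then invariant under \<open>h\<close> in both
    directions away from \<open>r\<close>, which is what makes its indicator a kernel
    vector.\<close>
  define g where "g i = (if i = r then r else h i)" for i
  define S where "S = {i. i < n \<and> (\<forall>k. (g ^^ k) i \<noteq> r)}"
  have rS: "r \<notin> S" unfolding S_def by (auto intro!: exI[of _ 0])
  have S_h: "h i \<in> S \<longleftrightarrow> i \<in> S" if i: "i < n" "i \<noteq> r" for i
  proof -
    have "(g ^^ Suc k) i = (g ^^ k) (h i)" for k using i by (simp add: funpow_swap1 g_def)
    then have "(\<forall>k. (g ^^ k) i \<noteq> r) \<longleftrightarrow> (\<forall>k. (g ^^ k) (h i) \<noteq> r)"
      using i(2) by (metis funpow_0 not0_implies_Suc)
    then show ?thesis using i h by (auto simp: S_def)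
  qed
  have "S \<noteq> {}"
  proof
    assume "S = {}"
    then have ex: "\<exists>k. (g ^^ k) i = r" if "i < n" for i using that by (auto simp: S_def)
    \<comment> \<open>If every index reached \<open>r\<close>, the number of steps needed would be a
      rank function.\<close>
    define d where "d i = (LEAST k. (g ^^ k) i = r)" for i
    have "d (h i) < d i" if i: "i < n" "i \<noteq> r" for i
    proof -
      have r: "(g ^^ d i) i = r" unfolding d_def by (rule LeastI_ex) (rule ex[OF i(1)])
      with i obtain k where k: "d i = Suc k" by (cases "d i") auto
      have "(g ^^ Suc k) i = (g ^^ k) (h i)" using i by (simp add: funpow_swap1 g_def)
      with r k have "(g ^^ k) (h i) = r" by simp
      then have "d (h i) \<le> k" unfolding d_def by (rule Least_le)
      then show ?thesis using k by simp
    qed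
    with False show False by blast
  qed
  define v where "v = vec n (\<lambda>i. of_bool (i \<in> S) :: 'a)"
  have v: "v \<in> carrier_vec n" by (simp add: v_def)
  have "v \<noteq> 0\<^sub>v n"
  proof
    assume "v = 0\<^sub>v n"
    moreover obtain i where "i \<in> S" using \<open>S \<noteq> {}\<close> by blast
    moreover have "i < n" using \<open>i \<in> S\<close> by (simp add: S_def)
    moreover have "v $ i = 1" using \<open>i \<in> S\<close> \<open>i < n\<close> by (simp add: v_def)
    ultimately show False by simp
  qed
  moreover have "M *\<^sub>v v = 0\<^sub>v n"
  proof (rule eq_vecI)
    fix i assume "i < dim_vec (0\<^sub>v n :: 'a vec)"
    then have i: "i < n" by simp
    have "(M *\<^sub>v v) $ i = (\<Sum>j = 0..<n. (of_bool (i = j) - of_bool (i \<noteq> r \<and> h i = j)) * of_bool (j \<in> S))"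
      using i by (simp add: M_def v_def scalar_prod_def)
    also have "\<dots> = (\<Sum>j = 0..<n. (if j = i then of_bool (i \<in> S) else 0) - (if j = h i then of_bool (i \<noteq> r \<and> h i \<in> S) else 0))"
      by (rule sum.cong) auto
    also have "\<dots> = of_bool (i \<in> S) - of_bool (i \<noteq> r \<and> h i \<in> S)"
      using i h[OF i] by (simp add: sum_subtractf)
    also have "\<dots> = 0" using S_h[OF i] rS by auto
    finally show "(M *\<^sub>v v) $ i = 0\<^sub>v n $ i" using i by simp
  qed (simp add: M_def)
  ultimately have "Determinant.det M = 0"
    using det_0_iff_vec_prod_zero[OF M] v by blast
  with False show ?thesis by (simp add: M_def)
qed

text \<open>Each row other than \<open>r\<close> is a sum of one functional row per outgoing arc, so
  by multilinearity the determinant is a sum over choice functions \<open>f\<close> of determinants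
  covered by \<open>det_functional_matrix\<close>, each 0 or 1.\<close>

lemma det_reduced_laplacian:
  fixes out :: "nat \<Rightarrow> 'e set" and h :: "'e \<Rightarrow> nat"
  assumes r: "r < n" and fin: "\<And>i. i < n \<Longrightarrow> finite (out i)"
    and h: "\<And>i e. i < n \<Longrightarrow> e \<in> out i \<Longrightarrow> h e < n"
  shows "Determinant.det (mat n n (\<lambda>(i, j).
           if i = r then of_bool (j = r)
           else \<Sum>e\<in>out i. of_bool (i = j) - of_bool (h e = j)) :: 'a :: idom mat) =
         of_nat (card {f \<in> PiE ({0..<n} - {r}) out.
           \<exists>d :: nat \<Rightarrow> nat. \<forall>i<n. i \<noteq> r \<longrightarrow> d (h (f i)) < d i})" (is "Determinant.det ?A = _")
proof -
  define F where "F = PiE ({0..<n} - {r}) out"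
  \<comment> \<open>\<open>f\<close> is \<open>undefined\<close> at \<open>r\<close>; the default
    target \<open>r\<close> only secures the bound \<open>h i < n\<close> demanded by
    \<open>det_functional_matrix\<close>, since the guard \<open>i \<noteq> r\<close> masks
    it.\<close>
  define M where "M f = (mat n n (\<lambda>(i, j).
      of_bool (i = j) - of_bool (i \<noteq> r \<and> (if i = r then r else h (f i)) = j)) :: 'a mat)" for f
  have finF: "finite F" unfolding F_def by (rule finite_PiE) (auto simp: fin)
  have prods: "(\<Prod>i = 0..<n. ?A $$ (i, p i)) = (\<Sum>f\<in>F. \<Prod>i = 0..<n. M f $$ (i, p i))"
    if p: "p permutes {0..<n}" for p
  proof -
    have pn: "p i < n" if "i < n" for i using permutes_in_image[OF p(1), of i] that by auto
    have split: "(\<Prod>i = 0..<n. g i) = g r * (\<Prod>i\<in>{0..<n} - {r}. g i)" for g :: "nat \<Rightarrow> 'a"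
      using r by (intro prod.remove) auto
    have "(\<Prod>i\<in>{0..<n} - {r}. ?A $$ (i, p i)) =
       (\<Prod>i\<in>{0..<n} - {r}. \<Sum>e\<in>out i. of_bool (i = p i) - of_bool (h e = p i))"
      by (rule prod.cong) (auto simp: pn)
    also have "\<dots> = (\<Sum>f\<in>F. \<Prod>i\<in>{0..<n} - {r}. of_bool (i = p i) - of_bool (h (f i) = p i))"
      unfolding F_def by (rule prod_sum_PiE) (auto simp: fin)
    also have "\<dots> = (\<Sum>f\<in>F. \<Prod>i\<in>{0..<n} - {r}. M f $$ (i, p i))"
      by (intro sum.cong prod.cong) (auto simp: M_def pn)
    finally have "(\<Prod>i = 0..<n. ?A $$ (i, p i)) =
        of_bool (p r = r) * (\<Sum>f\<in>F. \<Prod>i\<in>{0..<n} - {r}. M f $$ (i, p i))"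
      by (simp add: split r pn)
    also have "\<dots> = (\<Sum>f\<in>F. M f $$ (r, p r) * (\<Prod>i\<in>{0..<n} - {r}. M f $$ (i, p i)))"
      by (simp add: sum_distrib_left M_def r pn eq_commute[of r])
    finally show ?thesis by (simp add: split)
  qed
  have "Determinant.det ?A = (\<Sum>p\<in>{p. p permutes {0..<n}}. signof p * (\<Prod>i = 0..<n. ?A $$ (i, p i)))"
    by (rule det_def') simp
  also have "\<dots> = (\<Sum>p\<in>{p. p permutes {0..<n}}. \<Sum>f\<in>F. signof p * (\<Prod>i = 0..<n. M f $$ (i, p i)))"
    using prods by (intro sum.cong refl) (simp only: mem_Collect_eq sum_distrib_left)
  also have "\<dots> = (\<Sum>f\<in>F. \<Sum>p\<in>{p. p permutes {0..<n}}. signof p * (\<Prod>i = 0..<n. M f $$ (i, p i)))"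
    by (rule sum.swap)
  also have "\<dots> = (\<Sum>f\<in>F. Determinant.det (M f))"
    by (intro sum.cong refl det_def'[symmetric]) (simp add: M_def)
  also have "\<dots> = (\<Sum>f\<in>F. of_bool (\<exists>d :: nat \<Rightarrow> nat. \<forall>i<n. i \<noteq> r \<longrightarrow> d (h (f i)) < d i))"
  proof (intro sum.cong refl)
    fix f assume f: "f \<in> F"
    have bound: "(if i = r then r else h (f i)) < n" if "i < n" for i
      using f h[of i "f i"] that r by (auto simp: F_def PiE_def Pi_def)
    have "Determinant.det (M f) = of_bool (\<exists>d :: nat \<Rightarrow> nat. \<forall>i<n. i \<noteq> r \<longrightarrow> d (if i = r then r else h (f i)) < d i)"
      unfolding M_def by (rule det_functional_matrix[OF _ r]) (rule bound)
    then
    show "Determinant.det (M f) = of_bool (\<exists>d :: nat \<Rightarrow> nat. \<forall>i<n. i \<noteq> r \<longrightarrow> d (h (f i)) < d i)"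
      by (simp cong: conj_cong imp_cong)
  qed
  also have "\<dots> = of_nat (card {f \<in> F. \<exists>d :: nat \<Rightarrow> nat. \<forall>i<n. i \<noteq> r \<longrightarrow> d (h (f i)) < d i})"
    using finF by (simp add: sum.If_cases of_bool_def Int_def)
  finally show ?thesis by (simp add: F_def)
qed

subsection \<open>Spanning trees as arborescences\<close>

text \<open>
  A spanning tree is encoded by the first arc of the path from each vertex \<open>v \<noteq> r\<close> to \<open>r\<close>. The rank
  function \<open>d\<close> expresses that following these arcs ends in \<open>r\<close>.
\<close>

definition arborescences :: "('v, 'e) pre_digraph \<Rightarrow> 'v \<Rightarrow> ('v \<Rightarrow> 'e) set" where
  "arborescences X r = {f \<in> \<Pi>\<^sub>E v \<in> verts X - {r}. {e \<in> arcs X. tail X e = v}.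
     \<exists>d :: 'v \<Rightarrow> nat. \<forall>v \<in> verts X - {r}. d (head X (f v)) < d v}"

text \<open>The arcs are taken in both directions because a spanning tree is closed under inversion.
  The record update leaves \<open>tail\<close> and \<open>head\<close> untouched, as
  \<open>compatible\<close> demands, so a spanning tree is determined by its arc set.\<close>

definition arborescence_graph ::
    "('v, 'e) pre_digraph \<Rightarrow> ('e \<Rightarrow> 'e) \<Rightarrow> 'v \<Rightarrow> ('v \<Rightarrow> 'e) \<Rightarrow> ('v, 'e) pre_digraph" where
  "arborescence_graph X arev r f =
     X\<lparr>arcs := f ` (verts X - {r}) \<union> (arev \<circ> f) ` (verts X - {r})\<rparr>"

lemma arborescence_graph_simps [simp]:
  "verts (arborescence_graph X arev r f) = verts X"
  "tail (arborescence_graph X arev r f) = tail X"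
  "head (arborescence_graph X arev r f) = head X"
  "arcs (arborescence_graph X arev r f) =
     f ` (verts X - {r}) \<union> (arev \<circ> f) ` (verts X - {r})"
  by (simp_all add: arborescence_graph_def)

lemma arborescences_arc:
  assumes "f \<in> arborescences X r" "v \<in> verts X - {r}"
  shows "f v \<in> arcs X" "tail X (f v) = v"
  using assms by (auto simp: arborescences_def dest!: PiE_mem)

lemma arborescences_rank:
  fixes X :: "('v, 'e) pre_digraph"
  assumes "f \<in> arborescences X r"
  obtains d :: "'v \<Rightarrow> nat" where "\<forall>v \<in> verts X - {r}. d (head X (f v)) < d v"
  using assms unfolding arborescences_def by blast

section \<open>Closed walks read by index, as in the definition of circuits\<close>

context wf_digraph
begin

lemma cas_nth:
  assumes "cas u p v" "Suc i < length p"
  shows "head G (p ! i) = tail G (p ! Suc i)"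
  using assms
proof (induction p arbitrary: u i)
  case (Cons e p)
  then show ?case by (cases i; cases p) auto
qed simp

lemma cas_closed_nth:
  assumes "cas u p u" "i < length p"
  shows "head G (p ! i) = tail G (p ! (Suc i mod length p))"
proof (cases "Suc i < length p")
  case True then show ?thesis using cas_nth[OF assms(1)] by simp
next
  case False
  with assms(2) have i: "Suc i = length p" by simp
  then have p: "p \<noteq> []" by auto
  then have "head G (p ! i) = head G (last p)" using i by (metis diff_Suc_1 last_conv_nth)
  moreover have "tail G (p ! 0) = u" "head G (last p) = u"
    using assms(1) p awlast_if_cas[OF assms(1)]
    by (simp_all add: awalk_verts_conv cas_simp hd_conv_nth[symmetric])
  ultimately show ?thesis using i by simp
qed

end

section \<open>The bijection between arborescences and spanning trees\<close>

context bidirected_digraph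
begin

lemma arborescence_graph_arcs:
  assumes "f \<in> arborescences G r" "e \<in> arcs (arborescence_graph G arev r f)"
  shows "e \<in> arcs G" "arev e \<in> arcs (arborescence_graph G arev r f)"
proof -
  from assms(2) obtain v where v: "v \<in> verts G - {r}" "e = f v \<or> e = arev (f v)" by auto
  then show "e \<in> arcs G" using arborescences_arc(1)[OF assms(1) v(1)] by auto
  show "arev e \<in> arcs (arborescence_graph G arev r f)" using v by auto
qed

lemma wf_digraph_arborescence_graph:
  assumes "f \<in> arborescences G r"
  shows "wf_digraph (arborescence_graph G arev r f)"
  using arborescence_graph_arcs(1)[OF assms]
  by unfold_locales (simp_all del: arborescence_graph_simps(4))

text \<open>Every arc of the tree is some \<open>f v\<close>, which strictly lowers the rank, or its
  inverse, which strictly raises it. Hence weak descent, all that is known at a vertex of maximal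
  rank, already identifies the arc.\<close>

lemma down_arc_eq:
  fixes d :: "'a \<Rightarrow> nat"
  assumes f: "f \<in> arborescences G r" and d: "\<forall>v \<in> verts G - {r}. d (head G (f v)) < d v"
    and e: "e \<in> arcs (arborescence_graph G arev r f)" and le: "d (head G e) \<le> d (tail G e)"
  shows "tail G e \<in> verts G - {r}" and "e = f (tail G e)"
proof -
  from e obtain v where v: "v \<in> verts G - {r}" "e = f v \<or> e = arev (f v)" by auto
  note fv = arborescences_arc[OF f v(1)]
  have "e \<noteq> arev (f v)"
  proof
    assume "e = arev (f v)"
    with fv le have "d v \<le> d (head G (f v))" by simp
    with d v(1) show False by (meson leD)
  qed
  with v have "e = f v" by simp
  with fv v show "tail G e \<in> verts G - {r}" "e = f (tail G e)" by simp_all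
qed

lemma arborescence_reachable:
  assumes "f \<in> arborescences G r" "v \<in> verts G" "r \<in> verts G"
  shows "v \<rightarrow>\<^sup>*\<^bsub>arborescence_graph G arev r f\<^esub> r"
    and "r \<rightarrow>\<^sup>*\<^bsub>arborescence_graph G arev r f\<^esub> v"
proof -
  let ?T = "arborescence_graph G arev r f"
  interpret T: wf_digraph ?T by (rule wf_digraph_arborescence_graph[OF assms(1)])
  obtain d :: "'a \<Rightarrow> nat" where d: "\<forall>v \<in> verts G - {r}. d (head G (f v)) < d v"
    using arborescences_rank[OF assms(1)] .
  note f = arborescences_arc[OF assms(1)]
  have "v \<rightarrow>\<^sup>*\<^bsub>?T\<^esub> r \<and> r \<rightarrow>\<^sup>*\<^bsub>?T\<^esub> v" using assms(2)
  proof (induction "d v" arbitrary: v rule: less_induct)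
    case less
    show ?case
    proof (cases "v = r")
      case True then show ?thesis using assms(3) by (simp add: T.reachable_refl)
    next
      case False
      with less.prems have v: "v \<in> verts G - {r}" by simp
      let ?w = "head G (f v)"
      have w: "?w \<in> verts G" using f(1)[OF v] by auto
      have IH: "?w \<rightarrow>\<^sup>*\<^bsub>?T\<^esub> r \<and> r \<rightarrow>\<^sup>*\<^bsub>?T\<^esub> ?w" using less.hyps[OF bspec[OF d v] w] .
      have "f v \<in> arcs ?T" "arev (f v) \<in> arcs ?T" using v by auto
      then have "v \<rightarrow>\<^bsub>?T\<^esub> ?w" "?w \<rightarrow>\<^bsub>?T\<^esub> v"
        using f[OF v] by (metis T.in_arcs_imp_in_arcs_ends arborescence_graph_simps(2,3) tail_arev head_arev)+
      with IH show ?thesis by (meson T.adj_reachable_trans T.reachable_adj_trans)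
    qed
  qed
  then show "v \<rightarrow>\<^sup>*\<^bsub>?T\<^esub> r" "r \<rightarrow>\<^sup>*\<^bsub>?T\<^esub> v" by auto
qed

lemma serre_spanning_tree_arborescence_graph:
  assumes f: "f \<in> arborescences G r" and r: "r \<in> verts G"
  shows "serre_spanning_tree (arborescence_graph G arev r f) G arev"
proof -
  let ?T = "arborescence_graph G arev r f"
  interpret T: wf_digraph ?T by (rule wf_digraph_arborescence_graph[OF f])
  obtain d :: "'a \<Rightarrow> nat" where d: "\<forall>v \<in> verts G - {r}. d (head G (f v)) < d v"
    using arborescences_rank[OF f] .
  note in_G = arborescence_graph_arcs(1)[OF f] and arev_T = arborescence_graph_arcs(2)[OF f]
  have "spanning ?T G"
    unfolding spanning_def subgraph_def compatible_def
    using in_G by (auto intro: wf_digraph_axioms T.wf_digraph_axioms simp del: arborescence_graph_simps(4))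
  moreover have "strongly_connected ?T"
    unfolding strongly_connected_def
  proof (intro conjI ballI)
    show "verts ?T \<noteq> {}" using r by auto
    fix u v assume "u \<in> verts ?T" "v \<in> verts ?T"
    then show "u \<rightarrow>\<^sup>*\<^bsub>?T\<^esub> v"
      using arborescence_reachable[OF f _ r] by (auto intro: T.reachable_trans)
  qed
  moreover have "\<not> circuit ?T arev p" for p
  proof
    assume circ: "circuit ?T arev p"
    then have p: "p \<noteq> []" and nb: "\<And>i. i < length p \<Longrightarrow> p ! (Suc i mod length p) \<noteq> arev (p ! i)"
      by (auto simp: circuit_def T.cycle_def)
    from circ obtain u where u: "T.awalk u p u" by (auto simp: circuit_def T.cycle_def)
    then have cas: "T.cas u p u" and arcs: "set p \<subseteq> arcs ?T" by (auto simp: T.awalk_def)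
    have step: "head G (p ! i) = tail G (p ! (Suc i mod length p))" if "i < length p" for i
      using T.cas_closed_nth[OF cas that] by simp
    have in_T: "p ! i \<in> arcs ?T" if "i < length p" for i using that arcs nth_mem by blast
    \<comment> \<open>At a vertex of maximal rank on the circuit, both incident arcs are the unique descending arc.\<close>
    let ?D = "(\<lambda>i. d (tail G (p ! i))) ` {..<length p}"
    have "Max ?D \<in> ?D" using p by (intro Max_in) auto
    then obtain j where j: "j < length p" and jmax: "d (tail G (p ! j)) = Max ?D" by auto
    have max: "d (tail G (p ! i)) \<le> d (tail G (p ! j))" if "i < length p" for i
      unfolding jmax using that by (intro Max_ge) auto
    \<comment> \<open>The cyclic predecessor of \<open>j\<close>: the arc \<open>p ! i\<close>
      enters the vertex that \<open>p ! j\<close> leaves.\<close>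
    define i where "i = (if j = 0 then length p - 1 else j - 1)"
    have i: "i < length p" "Suc i mod length p = j" using j by (auto simp: i_def)
    have "p ! j = f (tail G (p ! j))"
    proof (rule down_arc_eq(2)[OF f d in_T[OF j]])
      show "d (head G (p ! j)) \<le> d (tail G (p ! j))"
        unfolding step[OF j] by (rule max) (use p in simp)
    qed
    moreover have "arev (p ! i) = f (tail G (arev (p ! i)))"
    proof (rule down_arc_eq(2)[OF f d arev_T[OF in_T[OF i(1)]]])
      show "d (head G (arev (p ! i))) \<le> d (tail G (arev (p ! i)))"
        using step[OF i(1)] in_G[OF in_T[OF i(1)]] max[OF i(1)] i(2) by simp
    qed
    moreover have "tail G (arev (p ! i)) = tail G (p ! j)"
      using step[OF i(1)] in_G[OF in_T[OF i(1)]] i(2) by simp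
    ultimately have "p ! (Suc i mod length p) = arev (p ! i)" using i(2) by simp
    with nb[OF i(1)] show False by simp
  qed
  ultimately show ?thesis
    unfolding serre_spanning_tree_def serre_tree_def using arev_T by blast
qed

text \<open>If \<open>f\<close> used the edge \<open>g v\<close> in the opposite direction, it would
  do so at the head \<open>w\<close> of \<open>g v\<close>. That vertex has smaller rank, so
  \<open>f w = g w\<close> by induction, and \<open>g\<close> would lead from \<open>w\<close> back
  up to \<open>v\<close>.\<close>

lemma arborescence_graph_inj:
  assumes f: "f \<in> arborescences G r" and g: "g \<in> arborescences G r"
    and eq: "arborescence_graph G arev r f = arborescence_graph G arev r g"
  shows "f = g"
proof -
  obtain d :: "'a \<Rightarrow> nat" where d: "\<forall>v \<in> verts G - {r}. d (head G (g v)) < d v"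
    using arborescences_rank[OF g] .
  have "f v = g v" if "v \<in> verts G - {r}" for v
    using that
  proof (induction "d v" arbitrary: v rule: less_induct)
    case less
    note gv = arborescences_arc[OF g less.prems]
    have "g v \<in> arcs (arborescence_graph G arev r g)" using less.prems by auto
    then have "g v \<in> arcs (arborescence_graph G arev r f)" by (simp only: eq)
    then obtain w where w: "w \<in> verts G - {r}" "g v = f w \<or> g v = arev (f w)" by auto
    note fw = arborescences_arc[OF f w(1)]
    from w(2) show ?case
    proof
      assume "g v = f w"
      with gv fw show ?thesis by metis
    next
      assume *: "g v = arev (f w)"
      with gv fw have hd: "head G (g v) = w" "head G (f w) = v" by (metis head_arev, metis tail_arev)
      with d less.prems have lt: "d w < d v" by metis
      then have "f w = g w" using less.hyps w(1) by blast
      with d w(1) hd have "d v < d w" by metis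
      with lt show ?thesis by simp
    qed
  qed
  then show ?thesis
    using f g by (auto simp: arborescences_def intro: PiE_ext)
qed

text \<open>The rank is the length of a shortest walk to \<open>r\<close> inside \<open>T\<close>,
  and \<open>f\<close> picks an arc of \<open>T\<close> that lowers it. Acyclicity of
  \<open>T\<close> enters in showing that \<open>T\<close> has no arcs beyond the chosen ones and
  their inverses.\<close>

lemma serre_spanning_tree_imp_arborescence_graph:
  assumes T: "serre_spanning_tree T G arev" and r: "r \<in> verts G"
  shows "\<exists>f \<in> arborescences G r. T = arborescence_graph G arev r f"
proof -
  from T have verts: "verts T = verts G" and tl: "tail T = tail G" and hd: "head T = head G"
    and arcs: "arcs T \<subseteq> arcs G" and wf: "wf_digraph T" and conn: "strongly_connected T"
    and nocirc: "\<And>p. \<not> circuit T arev p" and arev_T: "\<And>e. e \<in> arcs T \<Longrightarrow> arev e \<in> arcs T"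
    by (auto simp: serre_spanning_tree_def spanning_def subgraph_def compatible_def serre_tree_def)
  interpret T: wf_digraph T by (rule wf)
  define d where "d v = (LEAST k. \<exists>p. T.awalk v p r \<and> length p = k)" for v
  have ex: "\<exists>e. e \<in> arcs T \<and> tail G e = v \<and> d (head G e) < d v" if v: "v \<in> verts G - {r}" for v
  proof -
    have "\<exists>k p. T.awalk v p r \<and> length p = k"
      using conn v r verts by (auto simp: strongly_connected_def T.reachable_awalk)
    then have "\<exists>p. T.awalk v p r \<and> length p = d v" unfolding d_def by (rule LeastI_ex)
    then obtain p where p: "T.awalk v p r" "length p = d v" by blast
    with v obtain e q where eq: "p = e # q" by (cases p) (auto simp: T.awalk_Nil_iff)
    with p have e: "e \<in> arcs T" "tail T e = v" "T.awalk (head T e) q r" by (auto simp: T.awalk_Cons_iff)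
    have "d (head T e) \<le> length q" unfolding d_def by (rule Least_le) (use e in blast)
    with e p eq tl hd show ?thesis by (intro exI[of _ e]) auto
  qed
  define f where "f = (\<lambda>v \<in> verts G - {r}. SOME e. e \<in> arcs T \<and> tail G e = v \<and> d (head G e) < d v)"
  have fT: "f v \<in> arcs T \<and> tail G (f v) = v \<and> d (head G (f v)) < d v" if "v \<in> verts G - {r}" for v
    using someI_ex[OF ex[OF that]] that by (simp add: f_def)
  have f: "f \<in> arborescences G r"
    unfolding arborescences_def
  proof (intro CollectI conjI exI[of _ d] ballI)
    show "f \<in> (\<Pi>\<^sub>E v \<in> verts G - {r}. {e \<in> arcs G. tail G e = v})"
      using fT arcs by (intro PiE_I) (auto simp: f_def)
    show "d (head G (f v)) < d v" if "v \<in> verts G - {r}" for v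
      using fT[OF that] by simp
  qed
  let ?S = "arborescence_graph G arev r f"
  interpret S: wf_digraph ?S by (rule wf_digraph_arborescence_graph[OF f])
  have ST: "arcs ?S \<subseteq> arcs T" using fT arev_T by auto
  note arev_S = arborescence_graph_arcs(2)[OF f]
  \<comment> \<open>Any further arc would close up to a circuit with the simple path of \<open>?S\<close> joining its end points.\<close>
  have "arcs T \<subseteq> arcs ?S"
  proof (rule subsetI, rule ccontr)
    fix e assume e: "e \<in> arcs T" and nS: "e \<notin> arcs ?S"
    have eG: "e \<in> arcs G" using e arcs by auto
    have "head G e \<rightarrow>\<^sup>*\<^bsub>?S\<^esub> r" "r \<rightarrow>\<^sup>*\<^bsub>?S\<^esub> tail G e"
      using arborescence_reachable[OF f _ r] eG by simp_all
    then have "head G e \<rightarrow>\<^sup>*\<^bsub>?S\<^esub> tail G e" by (rule S.reachable_trans)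
    then obtain p where p: "S.apath (head G e) p (tail G e)" by (auto simp: S.reachable_apath)
    have Sp: "set p \<subseteq> arcs ?S" and casS: "S.cas (head G e) p (tail G e)"
      and dist: "distinct (S.awalk_verts (head G e) p)"
      using p by (auto simp: S.apath_def S.awalk_def simp del: arborescence_graph_simps(4))
    have cas_eq: "T.cas u q v \<longleftrightarrow> S.cas u q v" for u q v
      by (induction q arbitrary: u) (simp_all add: tl hd)
    have verts_eq: "T.awalk_verts u q = S.awalk_verts u q" for u q
      by (simp add: T.awalk_verts_conv S.awalk_verts_conv tl hd)
    have "T.cycle (e # p)"
      unfolding T.cycle_def
    proof (intro exI[of _ "tail G e"] conjI)
      show "T.awalk (tail G e) (e # p) (tail G e)"
        using eG e Sp ST casS by (auto simp: T.awalk_def verts tl hd cas_eq simp del: arborescence_graph_simps(4))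
      show "distinct (tl (T.awalk_verts (tail G e) (e # p)))"
        using dist by (simp add: verts_eq hd)
    qed simp
    moreover have "(e # p) ! (Suc i mod length (e # p)) \<noteq> arev ((e # p) ! i)"
      if i: "i < length (e # p)" for i
    proof
      let ?q = "e # p" and ?j = "Suc i mod length (e # p)"
      assume eq: "?q ! ?j = arev (?q ! i)"
      have j: "?j < length ?q" by simp
      have mem: "?q ! k \<in> arcs ?S" if "?q ! k \<noteq> e" "k < length ?q" for k
        using that Sp nth_mem[of k ?q] by auto
      have "set ?q \<subseteq> arcs G" using Sp ST arcs eG by (simp del: arborescence_graph_simps(4))
      then have iG: "?q ! i \<in> arcs G" using nth_mem[OF i] by blast
      \<comment> \<open>A backtrack cannot involve \<open>e\<close>: its partner would be
        \<open>e\<close> itself, excluded by \<open>arev_neq\<close>, or an arc of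
        \<open>?S\<close>, which is closed under inversion and does not contain \<open>e\<close>.
        This also covers the case that \<open>e\<close> is a loop and \<open>p\<close> is
        empty.\<close>
      have ne: "?q ! ?j \<noteq> e" "?q ! i \<noteq> e"
        using eq mem[OF _ i] mem[OF _ j] arev_S nS arev_neq[OF eG] arev_arev by metis+
      then obtain k where k: "i = Suc k" by (cases i) auto
      have "?j \<noteq> 0" using ne by (metis nth_Cons_0)
      then have "Suc i < length ?q" using i by (metis Suc_lessI mod_self)
      with k have jk: "?j = Suc (Suc k)" "Suc k < length p" by auto
      \<comment> \<open>A backtrack inside \<open>p\<close> returns to the same vertex after two
        steps, contradicting that \<open>p\<close> is a simple path.\<close>
      from eq k jk have pk: "p ! Suc k = arev (p ! k)" by simp
      have "p ! k \<in> arcs G" using iG k by simp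
      then have "head G (p ! Suc k) = tail G (p ! k)" using pk by simp
      moreover have "S.awalk_verts (head G e) p ! k = tail G (p ! k)"
        using jk(2) by (auto simp: S.awalk_verts_conv nth_append)
      moreover have "S.awalk_verts (head G e) p ! Suc (Suc k) = head G (p ! Suc k)"
        using jk(2) by (auto simp: S.awalk_verts_conv'[OF casS])
      ultimately have "S.awalk_verts (head G e) p ! Suc (Suc k) = S.awalk_verts (head G e) p ! k" by simp
      then show False
        using dist jk(2) by (simp add: nth_eq_iff_index_eq S.length_awalk_verts)
    qed
    ultimately show False using nocirc[of "e # p"] by (simp add: circuit_def)
  qed
  with ST have "arcs T = arcs ?S" by (rule equalityI[rotated])
  then have "T = ?S"
    using verts tl hd by (intro pre_digraph.equality) (simp_all del: arborescence_graph_simps(4))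
  with f show ?thesis by blast
qed

theorem num_spanning_trees_eq_card_arborescences:
  assumes "r \<in> verts G"
  shows "num_spanning_trees G arev = card (arborescences G r)"
proof -
  have "bij_betw (arborescence_graph G arev r) (arborescences G r) {T. serre_spanning_tree T G arev}"
    unfolding bij_betw_def
    using serre_spanning_tree_arborescence_graph[OF _ assms]
      serre_spanning_tree_imp_arborescence_graph[OF _ assms]
    by (auto simp: inj_on_def intro: arborescence_graph_inj)
  then show ?thesis
    unfolding num_spanning_trees_def by (simp add: bij_betw_same_card)
qed

end

subsection \<open>The matrix tree theorem\<close>

lemma index_mat_mat_mult:
  assumes "i < n" "j < n"
  shows "(mat n n f * mat n n g) $$ (i, j) = (\<Sum>k<n. f (i, k) * g (k, j) :: 'a :: semiring_0)"
  using assms by (simp add: scalar_prod_def atLeast0LessThan)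

lemma prod_list_diag_mat:
  "A \<in> carrier_mat n m \<Longrightarrow> prod_list (diag_mat A) = (\<Prod>i<n. A $$ (i, i))"
  by (simp add: diag_mat_def prod.distinct_set_conv_list[symmetric] atLeast0LessThan)

lemma sum_lessThan_remove_0:
  "0 < n \<Longrightarrow> (\<Sum>k<n. f k) = f 0 + (\<Sum>k\<in>{..<n} - {0 :: nat}. f k :: 'a :: comm_monoid_add)"
  by (rule sum.remove) auto

text \<open>
  The two matrices are related by unimodular row and column operations and one rescaling: adding up
  all rows and all columns of \<open>a + s\<close> isolates the factor \<open>s * n\<^sup>2\<close>.
\<close>

lemma det_add_const:
  fixes a :: "nat \<Rightarrow> nat \<Rightarrow> 'a :: field_char_0"
  assumes n: "0 < n" and row: "\<And>i. i < n \<Longrightarrow> (\<Sum>j<n. a i j) = 0"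
    and col: "\<And>j. j < n \<Longrightarrow> (\<Sum>i<n. a i j) = 0"
  shows "Determinant.det (mat n n (\<lambda>(i, j). a i j + s)) =
    s * of_nat n ^ 2 * Determinant.det (mat n n (\<lambda>(i, j). if i = 0 then of_bool (j = 0) else a i j))"
proof -
  let ?N = "of_nat n :: 'a"
  define M where "M = mat n n (\<lambda>(i, j). a i j + s)"
  define A0 where "A0 = mat n n (\<lambda>(i, j). if i = 0 then of_bool (j = 0) else a i j)"
  define E where "E = mat n n (\<lambda>(i, j). of_bool (i = 0 \<or> i = j) :: 'a)"
  define E' where "E' = mat n n (\<lambda>(i, j). of_bool (j = 0 \<or> i = j) :: 'a)"
  \<comment> \<open>\<open>E\<close> and \<open>E'\<close> add all rows to row 0 and all columns to
    column 0. \<open>H\<close> spreads 1/N along row 0 of the reduced matrix; then \<open>F\<close>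
    adds s N times this row to each other row, which restores \<open>s\<close> there and puts s N in
    column 0, and scales row 0 by s N^2.\<close>
  define F where "F = mat n n (\<lambda>(i, j). if j = 0 then (if i = 0 then s * ?N ^ 2 else s * ?N) else of_bool (i = j))"
  define H where "H = mat n n (\<lambda>(i, j). if i = j then 1 else if i = 0 then 1 / ?N else 0)"
  note defs = M_def A0_def E_def E'_def F_def H_def
  have carr: "M \<in> carrier_mat n n" "A0 \<in> carrier_mat n n" "E \<in> carrier_mat n n"
    "E' \<in> carrier_mat n n" "F \<in> carrier_mat n n" "H \<in> carrier_mat n n"
    by (simp_all add: defs)
  have N0: "?N \<noteq> 0" using n by simp
  have sum_delta: "(\<Sum>k<n. of_bool (i = k) * f k) = f i" "(\<Sum>k<n. f k * of_bool (k = i)) = f i"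
    if "i < n" for f :: "nat \<Rightarrow> 'a" and i
    using that by (simp_all add: of_bool_def if_distrib if_distribR sum.delta sum.delta' cong: if_cong)
  have detE: "Determinant.det E = 1"
  proof -
    have "upper_triangular E" by (auto simp: E_def upper_triangular_def)
    from det_upper_triangular[OF this carr(3)] show ?thesis
      by (simp add: prod_list_diag_mat[OF carr(3)]) (simp add: E_def)
  qed
  have detE': "Determinant.det E' = 1"
  proof -
    have "Determinant.det E' = prod_list (diag_mat E')"
      by (rule det_lower_triangular[OF _ carr(4)]) (auto simp: E'_def)
    then show ?thesis by (simp add: prod_list_diag_mat[OF carr(4)]) (simp add: E'_def)
  qed
  have detH: "Determinant.det H = 1"
  proof -
    have "upper_triangular H" by (auto simp: H_def upper_triangular_def)
    from det_upper_triangular[OF this carr(6)] show ?thesis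
      by (simp add: prod_list_diag_mat[OF carr(6)]) (simp add: H_def)
  qed
  have detF: "Determinant.det F = s * ?N ^ 2"
  proof -
    have "Determinant.det F = (\<Prod>i<n. F $$ (i, i))"
      unfolding prod_list_diag_mat[OF carr(5), symmetric]
      by (rule det_lower_triangular[OF _ carr(5)]) (auto simp: F_def)
    also have "\<dots> = F $$ (0, 0) * (\<Prod>i\<in>{..<n} - {0}. F $$ (i, i))"
      using n by (intro prod.remove) auto
    also have "(\<Prod>i\<in>{..<n} - {0}. F $$ (i, i)) = 1"
      by (rule prod.neutral) (auto simp: F_def)
    finally show ?thesis using n by (simp add: F_def)
  qed
  have "E * M = mat n n (\<lambda>(i, j). if i = 0 then s * ?N else a i j + s)"
  proof (rule eq_matI)
    fix i j assume "i < dim_row (mat n n (\<lambda>(i, j). if i = 0 then s * ?N else a i j + s))"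
      "j < dim_col (mat n n (\<lambda>(i, j). if i = 0 then s * ?N else a i j + s))"
    then have ij: "i < n" "j < n" by simp_all
    have "(E * M) $$ (i, j) = (\<Sum>k<n. of_bool (i = 0 \<or> i = k) * (a k j + s))"
      unfolding E_def M_def by (subst index_mat_mat_mult) (simp_all add: ij)
    also have "\<dots> = (if i = 0 then s * ?N else a i j + s)"
      using ij by (simp add: sum_delta sum.distrib col mult.commute)
    finally show "(E * M) $$ (i, j) = mat n n (\<lambda>(i, j). if i = 0 then s * ?N else a i j + s) $$ (i, j)"
      using ij by simp
  qed (simp_all add: E_def M_def)
  then have EME: "(E * M) * E' = mat n n (\<lambda>(i, j). if i = 0 then (if j = 0 then s * ?N ^ 2 else s * ?N)
      else if j = 0 then s * ?N else a i j + s)" (is "_ = ?K")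
  proof (intro eq_matI)
    fix i j assume EM: "E * M = mat n n (\<lambda>(i, j). if i = 0 then s * ?N else a i j + s)"
      and "i < dim_row ?K" "j < dim_col ?K"
    then have ij: "i < n" "j < n" by simp_all
    have "((E * M) * E') $$ (i, j) = (\<Sum>k<n. (if i = 0 then s * ?N else a i k + s) * of_bool (j = 0 \<or> k = j))"
      unfolding EM E'_def by (subst index_mat_mat_mult) (simp_all add: ij)
    also have "\<dots> = ?K $$ (i, j)"
      using ij by (auto simp: sum_delta sum.distrib row mult.commute power2_eq_square)
    finally show "((E * M) * E') $$ (i, j) = ?K $$ (i, j)" .
  qed (simp_all add: E_def E'_def M_def)
  have AE: "A0 * E' = mat n n (\<lambda>(i, j). if i = 0 then of_bool (j = 0) else if j = 0 then 0 else a i j)" (is "_ = ?B")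
  proof (rule eq_matI)
    fix i j assume "i < dim_row ?B" "j < dim_col ?B"
    then have ij: "i < n" "j < n" by simp_all
    have "(A0 * E') $$ (i, j) = (\<Sum>k<n. (if i = 0 then of_bool (k = 0) else a i k) * of_bool (j = 0 \<or> k = j))"
      unfolding A0_def E'_def by (subst index_mat_mat_mult) (simp_all add: ij)
    also have "\<dots> = ?B $$ (i, j)"
      using ij n row[of i] sum_delta(2)[of 0 "\<lambda>_. 1"] by (auto simp: sum_delta)
    finally show "(A0 * E') $$ (i, j) = ?B $$ (i, j)" .
  qed (simp_all add: A0_def E'_def)
  have BH: "?B * H = mat n n (\<lambda>(i, j). if i = 0 then (if j = 0 then 1 else 1 / ?N) else if j = 0 then 0 else a i j)" (is "_ = ?C")
  proof (rule eq_matI)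
    fix i j assume "i < dim_row ?C" "j < dim_col ?C"
    then have ij: "i < n" "j < n" by simp_all
    have "(?B * H) $$ (i, j) = (\<Sum>k<n. (if i = 0 then of_bool (k = 0) else if k = 0 then 0 else a i k) *
        (if k = j then 1 else if k = 0 then 1 / ?N else 0))"
      unfolding H_def by (subst index_mat_mat_mult) (simp_all add: ij)
    also have "\<dots> = (\<Sum>k<n. if i = 0 then of_bool (0 = k) * (if k = j then 1 else 1 / ?N)
        else (if k = 0 then 0 else a i k) * of_bool (k = j))"
      by (rule sum.cong) auto
    also have "\<dots> = ?C $$ (i, j)"
      using ij n by (auto simp: sum_delta)
    finally show "(?B * H) $$ (i, j) = ?C $$ (i, j)" .
  qed (simp_all add: H_def)
  have "F * ?C = ?K"
  proof (rule eq_matI)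
    fix i j assume "i < dim_row ?K" "j < dim_col ?K"
    then have ij: "i < n" "j < n" by simp_all
    have "(F * ?C) $$ (i, j) = (\<Sum>k<n. (if k = 0 then (if i = 0 then s * ?N ^ 2 else s * ?N) else of_bool (i = k)) *
        (if k = 0 then (if j = 0 then 1 else 1 / ?N) else if j = 0 then 0 else a k j))"
      unfolding F_def by (subst index_mat_mat_mult) (simp_all add: ij)
    also have "\<dots> = (if i = 0 then s * ?N ^ 2 else s * ?N) * (if j = 0 then 1 else 1 / ?N) +
        (\<Sum>k\<in>{..<n} - {0}. of_bool (i = k) * (if j = 0 then 0 else a k j))"
      using n by (simp add: sum_lessThan_remove_0)
    also have "(\<Sum>k\<in>{..<n} - {0}. of_bool (i = k) * (if j = 0 then 0 else a k j)) =
        (if i = 0 \<or> j = 0 then 0 else a i j)"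
    proof -
      have "(\<Sum>k\<in>{..<n} - {0}. of_bool (i = k) * (if j = 0 then 0 else a k j)) =
          (\<Sum>k\<in>{..<n} - {0}. if k = i then (if j = 0 then 0 else a i j) else 0)"
        by (rule sum.cong) auto
      also have "\<dots> = (if i \<in> {..<n} - {0} then (if j = 0 then 0 else a i j) else 0)"
        by (rule sum.delta) simp
      finally show ?thesis using ij by simp
    qed
    also have "(if i = 0 then s * ?N ^ 2 else s * ?N) * (if j = 0 then 1 else 1 / ?N) +
        (if i = 0 \<or> j = 0 then 0 else a i j) = ?K $$ (i, j)"
      using ij N0 by (simp add: power2_eq_square)
    finally show "(F * ?C) $$ (i, j) = ?K $$ (i, j)" .
  qed (simp_all add: F_def)
  then have "(E * M) * E' = F * ((A0 * E') * H)" by (simp only: EME AE BH)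
  then have "Determinant.det ((E * M) * E') = Determinant.det (F * ((A0 * E') * H))" by simp
  then have "Determinant.det M = s * ?N ^ 2 * Determinant.det A0"
    using carr by (simp add: det_mult[of _ n] detE detE' detF detH)
  then show ?thesis by (simp add: M_def A0_def)
qed

text \<open>Degree minus adjacency, written with one difference per outgoing arc: this is the shape
  of the rows in \<open>det_reduced_laplacian\<close>. When \<open>vs\<close> is distinct, a loop
  contributes 0.\<close>

definition laplacian :: "('v, 'e) pre_digraph \<Rightarrow> 'v list \<Rightarrow> nat \<Rightarrow> nat \<Rightarrow> 'a :: comm_ring_1" where
  "laplacian X vs i j = (\<Sum>e\<in>{e \<in> arcs X. tail X e = vs ! i}. of_bool (i = j) - of_bool (head X e = vs ! j))"

lemma sum_of_bool_nth:
  assumes "distinct vs" "v \<in> set vs"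
  shows "(\<Sum>i<length vs. of_bool (v = vs ! i)) = (1 :: 'a :: semiring_1)"
proof -
  obtain k where k: "k < length vs" "v = vs ! k" using assms(2) by (auto simp: in_set_conv_nth)
  then have "v = vs ! i \<longleftrightarrow> i = k" if "i < length vs" for i
    using assms(1) that by (simp add: nth_eq_iff_index_eq eq_commute)
  then have "(\<Sum>i<length vs. of_bool (v = vs ! i)) = (\<Sum>i<length vs. if i = k then 1 else 0 :: 'a)"
    by (intro sum.cong) auto
  then show ?thesis using k by simp
qed

text \<open>Choices at vertices and at matrix indices correspond through \<open>vs\<close> and its
  inverse \<open>idx\<close>. Both transports are restricted, since members of \<open>PiE\<close>
  are \<open>undefined\<close> off their domain.\<close>

lemma (in bidirected_digraph) card_arborescences_nth:
  assumes vs: "distinct vs" "set vs = verts G" "vs \<noteq> []"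
    and idx: "\<And>v. v \<in> verts G \<Longrightarrow> idx v < length vs \<and> vs ! idx v = v"
  shows "card (arborescences G (vs ! 0)) =
    card {f \<in> PiE ({0..<length vs} - {0}) (\<lambda>i. {e \<in> arcs G. tail G e = vs ! i}).
        \<exists>d :: nat \<Rightarrow> nat. \<forall>i<length vs. i \<noteq> 0 \<longrightarrow> d (idx (head G (f i))) < d i}"
proof -
  let ?n = "length vs"
  let ?I = "{0..<?n} - {0}" and ?V = "verts G - {vs ! 0}"
  let ?out = "\<lambda>v. {e \<in> arcs G. tail G e = v}"
  have idx_nth: "idx (vs ! i) = i" if "i < ?n" for i
    using idx[of "vs ! i"] that vs nth_eq_iff_index_eq[OF vs(1)] nth_mem by metis
  have nth_V: "vs ! i \<in> ?V" if "i \<in> ?I" for i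
    using that vs nth_eq_iff_index_eq[OF vs(1), of i 0] nth_mem[of i vs] by auto
  have idx_I: "idx v \<in> ?I" if "v \<in> ?V" for v
    using that idx[of v] by (auto intro: Suc_leI gr0I)
  have hd: "head G (f i) \<in> verts G" if "f \<in> PiE ?I (\<lambda>i. ?out (vs ! i))" "i \<in> ?I" for f i
    using PiE_mem[OF that] by auto
  let ?B = "{f \<in> PiE ?I (\<lambda>i. ?out (vs ! i)).
        \<exists>d :: nat \<Rightarrow> nat. \<forall>i<?n. i \<noteq> 0 \<longrightarrow> d (idx (head G (f i))) < d i}"
  have "bij_betw (\<lambda>f. \<lambda>i\<in>?I. f (vs ! i)) (arborescences G (vs ! 0)) ?B"
  proof (rule bij_betw_byWitness[where f' = "\<lambda>f. \<lambda>v\<in>?V. f (idx v)"])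
    show "\<forall>f\<in>arborescences G (vs ! 0). (\<lambda>v\<in>?V. (\<lambda>i\<in>?I. f (vs ! i)) (idx v)) = f"
    proof (intro ballI ext)
      fix f v assume f: "f \<in> arborescences G (vs ! 0)"
      show "(\<lambda>v\<in>?V. (\<lambda>i\<in>?I. f (vs ! i)) (idx v)) v = f v"
      proof (cases "v \<in> ?V")
        case True then show ?thesis using idx_I[OF True] idx[of v] by simp
      next
        case False
        have "f \<in> PiE ?V ?out" using f unfolding arborescences_def by (simp only: mem_Collect_eq)
        then have "f v = undefined" using False by (rule PiE_arb)
        then show ?thesis using False by (simp only: restrict_apply if_False)
      qed
    qed
    show "\<forall>f\<in>?B. (\<lambda>i\<in>?I. (\<lambda>v\<in>?V. f (idx v)) (vs ! i)) = f"
    proof (intro ballI ext)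
      fix f i assume f: "f \<in> ?B"
      show "(\<lambda>i\<in>?I. (\<lambda>v\<in>?V. f (idx v)) (vs ! i)) i = f i"
      proof (cases "i \<in> ?I")
        case True then show ?thesis using nth_V[OF True] idx_nth[of i] by auto
      next
        case False
        have "f \<in> PiE ?I (\<lambda>i. ?out (vs ! i))" using f by (simp only: mem_Collect_eq)
        then have "f i = undefined" using False by (rule PiE_arb)
        then show ?thesis using False by (simp only: restrict_apply if_False)
      qed
    qed
    show "(\<lambda>f. \<lambda>i\<in>?I. f (vs ! i)) ` arborescences G (vs ! 0) \<subseteq> ?B"
    proof (rule image_subsetI)
      fix f assume f: "f \<in> arborescences G (vs ! 0)"
      obtain d :: "'a \<Rightarrow> nat" where d: "\<forall>v \<in> ?V. d (head G (f v)) < d v"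
        using arborescences_rank[OF f] .
      have "\<forall>i<?n. i \<noteq> 0 \<longrightarrow> d (vs ! idx (head G ((\<lambda>i\<in>?I. f (vs ! i)) i))) < d (vs ! i)"
      proof (intro allI impI)
        fix i assume i: "i < ?n" "i \<noteq> 0"
        then have v: "vs ! i \<in> ?V" using nth_V[of i] by simp
        then have "head G (f (vs ! i)) \<in> verts G" using arborescences_arc(1)[OF f v] by simp
        then show "d (vs ! idx (head G ((\<lambda>i\<in>?I. f (vs ! i)) i))) < d (vs ! i)"
          using i d v idx by simp
      qed
      moreover have "(\<lambda>i\<in>?I. f (vs ! i)) \<in> PiE ?I (\<lambda>i. ?out (vs ! i))"
        using arborescences_arc[OF f nth_V] by auto
      ultimately show "(\<lambda>i\<in>?I. f (vs ! i)) \<in> ?B"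
        by (intro CollectI conjI exI[of _ "\<lambda>i. d (vs ! i)"])
    qed
    show "(\<lambda>f. \<lambda>v\<in>?V. f (idx v)) ` ?B \<subseteq> arborescences G (vs ! 0)"
    proof (rule image_subsetI)
      fix f assume f: "f \<in> ?B"
      then obtain d :: "nat \<Rightarrow> nat" where d: "\<forall>i<?n. i \<noteq> 0 \<longrightarrow> d (idx (head G (f i))) < d i" by blast
      have "f \<in> PiE ?I (\<lambda>i. ?out (vs ! i))" using f by (simp only: mem_Collect_eq)
      then have fI: "f i \<in> ?out (vs ! i)" if "i \<in> ?I" for i using that by (rule PiE_mem)
      have "f (idx v) \<in> ?out v" if "v \<in> ?V" for v
        using fI[OF idx_I[OF that]] idx[of v] that by simp
      moreover have "d (idx (head G (f (idx v)))) < d (idx v)" if "v \<in> ?V" for v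
        using d idx_I[OF that] by simp
      ultimately show "(\<lambda>v\<in>?V. f (idx v)) \<in> arborescences G (vs ! 0)"
        unfolding arborescences_def by (intro CollectI conjI exI[of _ "\<lambda>v. d (idx v)"]) auto
    qed
  qed
  then show ?thesis by (rule bij_betw_same_card)
qed

text \<open>The constant is left free because two values are needed: \<open>s = 1\<close> for the
  cover and \<open>s = n\<close> for the base graph.\<close>

theorem matrix_tree:
  assumes "bidirected_digraph X arev" "fin_digraph X"
    and vs: "distinct vs" "set vs = verts X" "vs \<noteq> []"
  shows "Determinant.det (mat (length vs) (length vs) (\<lambda>(i, j). laplacian X vs i j + s)) =
     s * of_nat (length vs) ^ 2 * (of_nat (num_spanning_trees X arev) :: 'a :: field_char_0)"
proof -
  interpret bidirected_digraph X arev by fact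
  interpret fin_digraph X by fact
  let ?n = "length vs"
  define idx where "idx v = (SOME i. i < ?n \<and> vs ! i = v)" for v
  have idx: "idx v < ?n \<and> vs ! idx v = v" if "v \<in> verts X" for v
    unfolding idx_def by (rule someI_ex) (metis that vs(2) in_set_conv_nth)
  have idx_eq: "v = vs ! j \<longleftrightarrow> idx v = j" if "v \<in> verts X" "j < ?n" for v j
    using idx[OF that(1)] that(2) nth_eq_iff_index_eq[OF vs(1)] by metis
  have fin: "finite {e \<in> arcs X. P e}" for P by simp
  have row: "(\<Sum>j<?n. laplacian X vs i j) = (0 :: 'a)" if i: "i < ?n" for i
  proof -
    have "(\<Sum>j<?n. laplacian X vs i j) = (\<Sum>e\<in>{e \<in> arcs X. tail X e = vs ! i}.
        (\<Sum>j<?n. of_bool (i = j)) - (\<Sum>j<?n. of_bool (head X e = vs ! j)) :: 'a)"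
      unfolding laplacian_def by (subst sum.swap) (simp add: sum_subtractf)
    also have "\<dots> = 0"
    proof (rule sum.neutral, rule ballI)
      fix e assume "e \<in> {e \<in> arcs X. tail X e = vs ! i}"
      then have "(\<Sum>j<?n. of_bool (head X e = vs ! j)) = (1 :: 'a)"
        by (intro sum_of_bool_nth[OF vs(1)]) (simp add: vs(2))
      moreover have "(\<Sum>j<?n. of_bool (i = j)) = (1 :: 'a)"
        unfolding of_bool_def using i by (subst sum.delta') simp_all
      ultimately show "(\<Sum>j<?n. of_bool (i = j)) - (\<Sum>j<?n. of_bool (head X e = vs ! j)) = (0 :: 'a)"
        by simp
    qed
    finally show ?thesis .
  qed
  have col: "(\<Sum>i<?n. laplacian X vs i j) = (0 :: 'a)" if j: "j < ?n" for j
  proof -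
    have "laplacian X vs i j = (\<Sum>e\<in>arcs X. of_bool (tail X e = vs ! i) * (of_bool (i = j) - of_bool (head X e = vs ! j)) :: 'a)" for i
      unfolding laplacian_def sum.inter_filter[OF finite_arcs] by (rule sum.cong) auto
    then have "(\<Sum>i<?n. laplacian X vs i j) = (\<Sum>e\<in>arcs X. \<Sum>i<?n. of_bool (tail X e = vs ! i) * (of_bool (i = j) - of_bool (head X e = vs ! j)) :: 'a)"
      by (simp only: sum.swap[of _ "arcs X"])
    also have "\<dots> = (\<Sum>e\<in>arcs X. of_bool (tail X e = vs ! j) - of_bool (head X e = vs ! j))"
    proof (rule sum.cong)
      fix e assume e: "e \<in> arcs X"
      have "(\<Sum>i<?n. of_bool (tail X e = vs ! i) * (of_bool (i = j) - of_bool (head X e = vs ! j)) :: 'a) =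
         (\<Sum>i<?n. if i = j then of_bool (tail X e = vs ! j) else 0) -
         (\<Sum>i<?n. of_bool (tail X e = vs ! i)) * of_bool (head X e = vs ! j)"
        unfolding sum_distrib_right sum_subtractf[symmetric]
        by (rule sum.cong) (auto simp: algebra_simps)
      also have "\<dots> = of_bool (tail X e = vs ! j) - of_bool (head X e = vs ! j)"
        using j e by (subst sum_of_bool_nth[OF vs(1)]) (simp_all add: vs(2))
      finally show "(\<Sum>i<?n. of_bool (tail X e = vs ! i) * (of_bool (i = j) - of_bool (head X e = vs ! j)) :: 'a) =
        of_bool (tail X e = vs ! j) - of_bool (head X e = vs ! j)" .
    qed simp
    also have "\<dots> = (\<Sum>e\<in>arcs X. of_bool (tail X e = vs ! j)) - (\<Sum>e\<in>arcs X. of_bool (head X e = vs ! j))"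
      by (rule sum_subtractf)
    \<comment> \<open>The inversion permutes the arcs and exchanges origin and terminus, so
      in-degree and out-degree agree.\<close>
    also have "(\<Sum>e\<in>arcs X. of_bool (tail X e = vs ! j) :: 'a) = (\<Sum>e\<in>arcs X. of_bool (tail X (arev e) = vs ! j))"
      using sum.permute[OF arev_permutes_arcs, of "\<lambda>e. of_bool (tail X e = vs ! j) :: 'a"] by (simp add: o_def)
    also have "\<dots> = (\<Sum>e\<in>arcs X. of_bool (head X e = vs ! j))"
      by (rule sum.cong) simp_all
    finally show ?thesis by simp
  qed
  have "mat ?n ?n (\<lambda>(i, j). if i = 0 then of_bool (j = 0) else laplacian X vs i j) =
      (mat ?n ?n (\<lambda>(i, j). if i = 0 then of_bool (j = 0)
         else \<Sum>e\<in>{e \<in> arcs X. tail X e = vs ! i}. of_bool (i = j) - of_bool (idx (head X e) = j)) :: 'a mat)"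
    by (rule cong_mat) (auto simp: laplacian_def idx_eq intro!: sum.cong)
  then have "Determinant.det (mat ?n ?n (\<lambda>(i, j). if i = 0 then of_bool (j = 0) else laplacian X vs i j)) =
      (of_nat (card {f \<in> PiE ({0..<?n} - {0}) (\<lambda>i. {e \<in> arcs X. tail X e = vs ! i}).
        \<exists>d :: nat \<Rightarrow> nat. \<forall>i<?n. i \<noteq> 0 \<longrightarrow> d (idx (head X (f i))) < d i}) :: 'a)"
    using vs(3) idx by (simp only:) (rule det_reduced_laplacian, auto)
  also have "\<dots> = of_nat (num_spanning_trees X arev)"
    using card_arborescences_nth[OF vs idx] num_spanning_trees_eq_card_arborescences[of "vs ! 0"] vs
      nth_mem[of 0 vs] by simp
  finally show ?thesis
    using vs(3) by (simp add: det_add_const row col)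
qed

subsection \<open>Block circulant matrices\<close>

definition unity_root :: "nat \<Rightarrow> nat \<Rightarrow> complex" where
  "unity_root n m = cis (2 * pi * real m / real n)"

lemma unity_root_0 [simp]: "unity_root n 0 = 1"
  by (simp add: unity_root_def)

lemma norm_unity_root [simp]: "cmod (unity_root n m) = 1"
  by (simp add: unity_root_def)

lemma unity_root_power_n: "0 < n \<Longrightarrow> unity_root n m ^ n = 1"
  using cis_multiple_2pi[of "real m"] by (simp add: unity_root_def DeMoivre mult_ac)

lemma unity_root_power_swap: "unity_root n m ^ k = unity_root n k ^ m"
  by (simp add: unity_root_def DeMoivre mult_ac)

lemma inj_on_unity_root: "inj_on (unity_root n) {..<n}"
proof (cases "n = 0")
  case False
  then show ?thesis
    using bij_betw_roots_unity[of n] by (simp add: bij_betw_def unity_root_def[abs_def])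
qed simp

lemma unity_root_eq_1_iff:
  assumes "m < n"
  shows "unity_root n m = 1 \<longleftrightarrow> m = 0"
  using inj_onD[OF inj_on_unity_root, of n m 0] assms by auto

lemma sum_powers_root_unity:
  fixes z :: "'a :: field"
  assumes "z ^ n = 1"
  shows "(\<Sum>k<n. z ^ k) = (if z = 1 then of_nat n else 0)"
  using assms by (simp add: sum_gp_strict)

text \<open>Exchanging index and exponent by \<open>unity_root_power_swap\<close> turns the sum into
  a geometric sum over powers of a single n-th root of unity, which equals 1 exactly when
  \<open>i = j\<close>.\<close>

lemma sum_unity_root_orthogonal:
  assumes "i < n" "j < n"
  shows "(\<Sum>k<n. unity_root n k ^ i * cnj (unity_root n k) ^ j) = (if i = j then of_nat n else 0)"
proof -
  have "unity_root n k ^ i * cnj (unity_root n k) ^ j = (unity_root n i * cnj (unity_root n j)) ^ k" for k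
    unfolding complex_cnj_power[symmetric] unity_root_power_swap[of n k]
    by (simp add: power_mult_distrib)
  moreover have "(unity_root n i * cnj (unity_root n j)) ^ n = 1"
    using assms by (simp add: power_mult_distrib unity_root_power_n flip: complex_cnj_power)
  moreover have "unity_root n i * cnj (unity_root n j) = 1 \<longleftrightarrow> i = j"
  proof -
    have cnj: "unity_root n j * cnj (unity_root n j) = 1" for j
      by (simp add: complex_norm_square[symmetric])
    have "unity_root n i * cnj (unity_root n j) = 1 \<longleftrightarrow> unity_root n i = unity_root n j"
      using cnj[of j] by (metis mult_cancel_right mult_zero_right zero_neq_one)
    then show ?thesis using inj_onD[OF inj_on_unity_root] assms by auto
  qed
  ultimately show ?thesis by (simp add: sum_powers_root_unity)
qed

text \<open>Indices of block matrices are encoded as \<open>q * g + r\<close>: the quotient is the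
  block, later the sheet of the cover, and the remainder is the position inside it, later the vertex
  of the base.\<close>

lemma sum_div_mod:
  fixes g :: nat
  assumes "0 < g"
  shows "(\<Sum>k<n * g. f (k div g) (k mod g)) = (\<Sum>q<n. \<Sum>r<g. f q r :: 'a :: comm_monoid_add)"
proof -
  have "(\<Sum>k<n * g. f (k div g) (k mod g)) = (\<Sum>q<n. \<Sum>k = q * g..<q * g + g. f (k div g) (k mod g))"
    by (rule sum.nat_group[symmetric])
  also have "\<dots> = (\<Sum>q<n. \<Sum>r<g. f q r)"
  proof (rule sum.cong)
    fix q :: nat
    have "(\<Sum>k = q * g..<q * g + g. f (k div g) (k mod g)) =
        (\<Sum>r = 0..<g. f ((r + q * g) div g) ((r + q * g) mod g))"
      using sum.shift_bounds_nat_ivl[of "\<lambda>k. f (k div g) (k mod g)" 0 "q * g" g] by (simp add: add.commute)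
    also have "\<dots> = (\<Sum>r<g. f q r)"
      using assms by (intro sum.cong) auto
    finally show "(\<Sum>k = q * g..<q * g + g. f (k div g) (k mod g)) = (\<Sum>r<g. f q r)" .
  qed simp
  finally show ?thesis .
qed

lemma div_mod_less:
  assumes "k < n * (g :: nat)"
  shows "k div g < n" "k mod g < g"
  using assms by (auto simp: less_mult_imp_div_less intro!: mod_less_divisor gr0I)

lemma det_block_diagonal:
  fixes B :: "nat \<Rightarrow> nat \<Rightarrow> nat \<Rightarrow> 'a :: idom"
  shows "Determinant.det (mat (n * g) (n * g) (\<lambda>(k, l).
      if k div g = l div g then B (l div g) (k mod g) (l mod g) else 0)) =
    (\<Prod>m<n. Determinant.det (mat g g (\<lambda>(i, j). B m i j)))"
proof (cases "g = 0")
  case False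
  define D where "D n = mat (n * g) (n * g) (\<lambda>(k, l).
      if k div g = l div g then B (l div g) (k mod g) (l mod g) else 0)" for n
  have "Determinant.det (D n) = (\<Prod>m<n. Determinant.det (mat g g (\<lambda>(i, j). B m i j)))"
  proof (induction n)
    case (Suc n)
    have "D (Suc n) = four_block_mat (D n) (0\<^sub>m (n * g) g) (0\<^sub>m g (n * g)) (mat g g (\<lambda>(i, j). B n i j))"
      (is "_ = ?F")
    proof (rule eq_matI)
      fix k l assume "k < dim_row ?F" "l < dim_col ?F"
      then have kl: "k < n * g + g" "l < n * g + g" by (simp_all add: D_def)
      have high: "q div g = n \<and> q mod g = q - n * g" if "\<not> q < n * g" "q < n * g + g" for q
      proof -
        from that have "q div g = n" by (intro div_nat_eqI) (auto simp: mult.commute)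
        then show ?thesis using minus_div_mult_eq_mod[of q g] by simp
      qed
      have low: "q div g < n" if "q < n * g" for q using that by (rule less_mult_imp_div_less)
      show "D (Suc n) $$ (k, l) = ?F $$ (k, l)"
        using kl high[of k] high[of l] low[of k] low[of l]
        by (cases "k < n * g"; cases "l < n * g") (auto simp: D_def add.commute)
    qed (simp_all add: D_def)
    then have "Determinant.det (D (Suc n)) = Determinant.det (D n) * Determinant.det (mat g g (\<lambda>(i, j). B n i j))"
      by (simp add: det_four_block_mat_lower_left_zero[of _ "n * g" _ g] D_def)
    then show ?case by (simp add: Suc.IH mult.commute)
  qed (simp add: D_def)
  then show ?thesis by (simp add: D_def)
qed simp

text \<open>Conjugation by the discrete Fourier transform block diagonalises a block circulant matrix.\<close>

lemma det_fourier:
  fixes a :: "nat \<Rightarrow> nat \<Rightarrow> nat \<Rightarrow> nat \<Rightarrow> complex" and B :: "nat \<Rightarrow> nat \<Rightarrow> nat \<Rightarrow> complex"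
  assumes eigen: "\<And>m p i j. m < n \<Longrightarrow> p < n \<Longrightarrow> i < g \<Longrightarrow> j < g \<Longrightarrow>
    (\<Sum>q<n. a p i q j * unity_root n m ^ q) = unity_root n m ^ p * B m i j"
  shows "Determinant.det (mat (n * g) (n * g) (\<lambda>(k, l). a (k div g) (k mod g) (l div g) (l mod g))) =
    (\<Prod>m<n. Determinant.det (mat g g (\<lambda>(i, j). B m i j)))"
proof (cases "n = 0 \<or> g = 0")
  case False
  then have n: "0 < n" and g: "0 < g" by auto
  define A where "A = mat (n * g) (n * g) (\<lambda>(k, l). a (k div g) (k mod g) (l div g) (l mod g))"
  \<comment> \<open>\<open>W\<close> is the Fourier matrix tensored with the identity of size
    \<open>g\<close>, and \<open>V\<close> is its conjugate transpose. The hypothesis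
    \<open>eigen\<close> gives \<open>A * W = W * D\<close>; since \<open>W * V\<close> is n times
    the identity, the determinant of \<open>W\<close> is nonzero and cancels.\<close>
  define W where "W = mat (n * g) (n * g) (\<lambda>(k, l). if k mod g = l mod g then unity_root n (l div g) ^ (k div g) else 0)"
  define V where "V = mat (n * g) (n * g) (\<lambda>(k, l). if k mod g = l mod g then cnj (unity_root n (k div g)) ^ (l div g) else 0)"
  define D where "D = mat (n * g) (n * g) (\<lambda>(k, l). if k div g = l div g then B (l div g) (k mod g) (l mod g) else 0)"
  have carr: "A \<in> carrier_mat (n * g) (n * g)" "W \<in> carrier_mat (n * g) (n * g)"
    "V \<in> carrier_mat (n * g) (n * g)" "D \<in> carrier_mat (n * g) (n * g)"
    by (simp_all add: A_def W_def V_def D_def)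
  have "A * W = W * D"
  proof (rule eq_matI)
    fix k l assume "k < dim_row (W * D)" "l < dim_col (W * D)"
    then have kl: "k < n * g" "l < n * g" by (simp_all add: W_def D_def)
    note k = div_mod_less[OF kl(1)] and l = div_mod_less[OF kl(2)]
    have "(A * W) $$ (k, l) = (\<Sum>x<n * g. a (k div g) (k mod g) (x div g) (x mod g) *
        (if x mod g = l mod g then unity_root n (l div g) ^ (x div g) else 0))"
      unfolding A_def W_def by (subst index_mat_mat_mult) (simp_all add: kl)
    also have "\<dots> = (\<Sum>q<n. \<Sum>r<g. a (k div g) (k mod g) q r *
        (if r = l mod g then unity_root n (l div g) ^ q else 0))"
      by (rule sum_div_mod[OF g])
    also have "\<dots> = (\<Sum>q<n. \<Sum>r<g. if r = l mod g then a (k div g) (k mod g) q (l mod g) * unity_root n (l div g) ^ q else 0)"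
      by (intro sum.cong) auto
    also have "\<dots> = (\<Sum>q<n. a (k div g) (k mod g) q (l mod g) * unity_root n (l div g) ^ q)"
      using l by simp
    also have "\<dots> = unity_root n (l div g) ^ (k div g) * B (l div g) (k mod g) (l mod g)"
      using k l by (intro eigen)
    also have "\<dots> = (\<Sum>q<n. if q = l div g then unity_root n (l div g) ^ (k div g) * B (l div g) (k mod g) (l mod g) else 0)"
      using l by simp
    also have "\<dots> = (\<Sum>q<n. \<Sum>r<g. if r = k mod g then (if q = l div g then unity_root n (l div g) ^ (k div g) * B (l div g) (k mod g) (l mod g) else 0) else 0)"
      using k by simp
    also have "\<dots> = (\<Sum>q<n. \<Sum>r<g. (if k mod g = r then unity_root n q ^ (k div g) else 0) *
        (if q = l div g then B (l div g) r (l mod g) else 0))"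
      by (intro sum.cong) auto
    also have "\<dots> = (\<Sum>x<n * g. (if k mod g = x mod g then unity_root n (x div g) ^ (k div g) else 0) *
        (if x div g = l div g then B (l div g) (x mod g) (l mod g) else 0))"
      by (rule sum_div_mod[OF g, symmetric])
    also have "\<dots> = (W * D) $$ (k, l)"
      unfolding W_def D_def by (subst index_mat_mat_mult) (simp_all add: kl)
    finally show "(A * W) $$ (k, l) = (W * D) $$ (k, l)" .
  qed (simp_all add: A_def W_def D_def)
  then have "Determinant.det A * Determinant.det W = Determinant.det W * Determinant.det D"
    using carr by (simp flip: det_mult[of _ "n * g"])
  moreover have "Determinant.det W \<noteq> 0"
  proof -
    have "W * V = of_nat n \<cdot>\<^sub>m 1\<^sub>m (n * g)"
    proof (rule eq_matI)
      fix k l assume "k < dim_row (of_nat n \<cdot>\<^sub>m 1\<^sub>m (n * g) :: complex mat)"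
        "l < dim_col (of_nat n \<cdot>\<^sub>m 1\<^sub>m (n * g) :: complex mat)"
      then have kl: "k < n * g" "l < n * g" by simp_all
      note k = div_mod_less[OF kl(1)] and l = div_mod_less[OF kl(2)]
      have "(W * V) $$ (k, l) = (\<Sum>x<n * g. (if k mod g = x mod g then unity_root n (x div g) ^ (k div g) else 0) *
          (if x mod g = l mod g then cnj (unity_root n (x div g)) ^ (l div g) else 0))"
        unfolding W_def V_def by (subst index_mat_mat_mult) (simp_all add: kl)
      also have "\<dots> = (\<Sum>q<n. \<Sum>r<g. (if k mod g = r then unity_root n q ^ (k div g) else 0) *
          (if r = l mod g then cnj (unity_root n q) ^ (l div g) else 0))"
        by (rule sum_div_mod[OF g])
      also have "\<dots> = (\<Sum>q<n. \<Sum>r<g. if r = k mod g then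
          (if k mod g = l mod g then unity_root n q ^ (k div g) * cnj (unity_root n q) ^ (l div g) else 0) else 0)"
        by (intro sum.cong) auto
      also have "\<dots> = (if k mod g = l mod g then \<Sum>q<n. unity_root n q ^ (k div g) * cnj (unity_root n q) ^ (l div g) else 0)"
        using k by simp
      also have "\<dots> = (if k = l then of_nat n else 0)"
        using k l by (simp add: sum_unity_root_orthogonal) (metis div_mult_mod_eq)
      finally show "(W * V) $$ (k, l) = (of_nat n \<cdot>\<^sub>m 1\<^sub>m (n * g)) $$ (k, l)"
        using kl by simp
    qed (simp_all add: W_def V_def)
    then have "Determinant.det W * Determinant.det V = of_nat n ^ (n * g)"
      using carr by (simp flip: det_mult[of _ "n * g"])
    then show ?thesis using n by auto
  qed
  ultimately have "Determinant.det A = Determinant.det D" by simp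
  then show ?thesis by (simp add: A_def D_def det_block_diagonal)
qed auto

subsection \<open>Cyclic covers\<close>

text \<open>The entries of \<open>D - A\<^sub>\<alpha>(z)\<close>.\<close>

definition twisted_laplacian ::
    "('v, 'e) pre_digraph \<Rightarrow> ('e \<Rightarrow> int) \<Rightarrow> 'v list \<Rightarrow> 'a :: field \<Rightarrow> nat \<Rightarrow> nat \<Rightarrow> 'a" where
  "twisted_laplacian X \<alpha> vs z i j =
     (\<Sum>e\<in>{e \<in> arcs X. tail X e = vs ! i}. of_bool (i = j) - of_bool (head X e = vs ! j) * z powi \<alpha> e)"

lemma twisted_laplacian_1: "twisted_laplacian X \<alpha> vs 1 = laplacian X vs"
  by (intro ext) (simp add: twisted_laplacian_def laplacian_def)

text \<open>The vertices are listed sheet by sheet, so that the sheets become the blocks. Sheets are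
  integers because the carrier of \<open>integer_mod_group n\<close> is \<open>{0..<int n}\<close>
  for positive \<open>n\<close>.\<close>

definition cover_vertices :: "nat \<Rightarrow> 'v list \<Rightarrow> ('v \<times> int) list" where
  "cover_vertices n vs = map (\<lambda>k. (vs ! (k mod length vs), int (k div length vs))) [0..<n * length vs]"

lemma length_cover_vertices [simp]: "length (cover_vertices n vs) = n * length vs"
  by (simp add: cover_vertices_def)

lemma nth_cover_vertices:
  "k < n * length vs \<Longrightarrow> cover_vertices n vs ! k = (vs ! (k mod length vs), int (k div length vs))"
  by (simp add: cover_vertices_def)

lemma distinct_cover_vertices:
  assumes "distinct vs"
  shows "distinct (cover_vertices n vs)"
proof -
  have "k = l" if kl: "k < n * length vs" "l < n * length vs"
    and "vs ! (k mod length vs) = vs ! (l mod length vs)" "int (k div length vs) = int (l div length vs)" for k l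
  proof -
    have "k mod length vs = l mod length vs"
      using that div_mod_less[OF kl(1)] div_mod_less[OF kl(2)] nth_eq_iff_index_eq[OF assms] by metis
    with that(4) show ?thesis by (metis of_nat_eq_iff div_mult_mod_eq)
  qed
  then show ?thesis
    by (auto simp: cover_vertices_def distinct_map inj_on_def)
qed

lemma set_cover_vertices: "set (cover_vertices n vs) = set vs \<times> {0..<int n}"
proof (intro equalityI subsetI)
  fix x assume "x \<in> set (cover_vertices n vs)"
  then obtain k where k: "k < n * length vs" "x = (vs ! (k mod length vs), int (k div length vs))"
    by (auto simp: cover_vertices_def)
  with div_mod_less[OF k(1)] show "x \<in> set vs \<times> {0..<int n}" by auto
next
  fix x assume "x \<in> set vs \<times> {0..<int n}"
  then obtain i q where iq: "i < length vs" "q < n" "x = (vs ! i, int q)"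
  proof -
    from \<open>x \<in> set vs \<times> {0..<int n}\<close> obtain v t where x: "x = (v, t)" "v \<in> set vs" "0 \<le> t" "t < int n" by auto
    obtain i where "i < length vs" "v = vs ! i" using x(2) by (auto simp: in_set_conv_nth)
    with x that[of i "nat t"] show ?thesis by simp
  qed
  define k where "k = q * length vs + i"
  have "k < Suc q * length vs" using iq(1) by (simp add: k_def)
  also have "\<dots> \<le> n * length vs" using iq(2) by (intro mult_le_mono1) simp
  finally have "k < n * length vs" .
  moreover have "k div length vs = q" "k mod length vs = i"
    using iq(1) by (cases "vs = []"; simp add: k_def)+
  ultimately show "x \<in> set (cover_vertices n vs)"
    using iq(3) unfolding cover_vertices_def by (force simp: image_iff)
qed

text \<open>Allows the reduction modulo n in the cover to be dropped in exponents, for voltages of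
  either sign.\<close>

lemma root_of_unity_power_nat_mod:
  fixes z :: "'a :: field"
  assumes "z ^ n = 1" "0 < n"
  shows "z ^ nat (k mod int n) = z powi k"
proof -
  have z: "z \<noteq> 0" using assms by (auto simp: power_0_left)
  have "z powi k = z powi (k mod int n + int n * (k div int n))" by simp
  also have "\<dots> = z powi (k mod int n) * (z powi int n) powi (k div int n)"
    using z by (subst power_int_add) (auto simp: power_int_mult)
  also have "\<dots> = z ^ nat (k mod int n)"
    using assms by (simp add: power_int_def)
  finally show ?thesis by simp
qed

text \<open>The arcs leaving a vertex of the cover are the lifts to its sheet of the arcs leaving
  the vertex below, so the entry becomes a sum over arcs of \<open>X\<close> in block
  coordinates.\<close>

lemma laplacian_derived_graph:
  assumes "fin_digraph X" and n: "0 < n" and k: "k < n * length vs" and l: "l < n * length vs"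
    and g: "g = length vs"
  shows "laplacian (derived_graph (integer_mod_group n) X (\<lambda>e. \<alpha> e mod int n)) (cover_vertices n vs) k l =
    ((\<Sum>e\<in>{e \<in> arcs X. tail X e = vs ! (k mod g)}. of_bool (k div g = l div g \<and> k mod g = l mod g) -
      of_bool (head X e = vs ! (l mod g) \<and> (int (k div g) + \<alpha> e) mod int n = int (l div g))) :: 'a :: comm_ring_1)"
proof -
  interpret fin_digraph X by fact
  let ?D = "derived_graph (integer_mod_group n) X (\<lambda>e. \<alpha> e mod int n)"
  let ?s = "int (k div g)"
  have s: "k div g < n" using div_mod_less[OF k] g by simp
  have set_eq: "{x \<in> arcs ?D. tail ?D x = cover_vertices n vs ! k} =
      (\<lambda>e. (e, ?s)) ` {e \<in> arcs X. tail X e = vs ! (k mod g)}"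
    using n s g by (auto simp: derived_graph_def carrier_integer_mod_group nth_cover_vertices[OF k])
  have kl: "k = l \<longleftrightarrow> k div g = l div g \<and> k mod g = l mod g" by (metis div_mult_mod_eq)
  have "laplacian ?D (cover_vertices n vs) k l =
      (\<Sum>e\<in>{e \<in> arcs X. tail X e = vs ! (k mod g)}. of_bool (k = l) -
        of_bool (head ?D (e, ?s) = cover_vertices n vs ! l) :: 'a)"
    unfolding laplacian_def set_eq by (subst sum.reindex) (auto simp: inj_on_def)
  also have "\<dots> = (\<Sum>e\<in>{e \<in> arcs X. tail X e = vs ! (k mod g)}. of_bool (k div g = l div g \<and> k mod g = l mod g) -
      of_bool (head X e = vs ! (l mod g) \<and> (int (k div g) + \<alpha> e) mod int n = int (l div g)))"
    using g by (simp add: kl derived_graph_def nth_cover_vertices[OF l] mod_add_right_eq)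
  finally show ?thesis .
qed

theorem num_spanning_trees_cyclic_cover:
  assumes X: "bidirected_digraph X arev" "fin_digraph X" and n: "0 < n"
    and \<alpha>: "voltage_assignment integer_group X arev \<alpha>"
    and vs: "distinct vs" "set vs = verts X" "vs \<noteq> []"
  shows "of_nat n * (of_nat (num_spanning_trees
              (derived_graph (integer_mod_group n) X (\<lambda>e. \<alpha> e mod int n))
              (derived_arev (integer_mod_group n) X arev (\<lambda>e. \<alpha> e mod int n)))) =
    of_nat (num_spanning_trees X arev) *
    (\<Prod>m\<in>{1..<n}. Determinant.det (mat (length vs) (length vs)
       (\<lambda>(i, j). twisted_laplacian X \<alpha> vs (unity_root n m) i j)))"
proof -
  interpret X: bidirected_digraph X arev by fact
  interpret X: fin_digraph X by fact
  let ?Z = "integer_mod_group n" and ?\<beta> = "\<lambda>e. \<alpha> e mod int n"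
  let ?D = "derived_graph ?Z X ?\<beta>" and ?r = "derived_arev ?Z X arev ?\<beta>"
  define g where "g = length vs"
  have g: "0 < g" using vs(3) by (simp add: g_def)
  have "voltage_assignment ?Z X arev ?\<beta>"
    using \<alpha> n by (auto simp: voltage_assignment_def carrier_integer_mod_group mod_minus_eq)
  then have D: "bidirected_digraph ?D ?r"
    by (intro bidirected_digraph_derived_graph X) simp
  interpret D: bidirected_digraph ?D ?r by (rule D)
  have finD: "fin_digraph ?D"
    using n by unfold_locales (simp_all add: derived_graph_def carrier_integer_mod_group)
  define ws where "ws = cover_vertices n vs"
  have ws: "distinct ws" "set ws = verts ?D" "ws \<noteq> []" "length ws = n * g"
    using vs n g distinct_cover_vertices[OF vs(1)]
    by (auto simp: ws_def g_def set_cover_vertices derived_graph_def carrier_integer_mod_group simp flip: length_greater_0_conv)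
  define a where "a p i q j = (\<Sum>e\<in>{e \<in> arcs X. tail X e = vs ! i}. of_bool (p = q \<and> i = j) -
      of_bool (head X e = vs ! j \<and> (int p + \<alpha> e) mod int n = int q)) + (1 :: complex)" for p i q j :: nat
  \<comment> \<open>Adding 1 to all entries adds the geometric sum of the powers of
    \<open>unity_root n m\<close> to a block: n for \<open>m = 0\<close> and 0 otherwise.\<close>
  define B where "B m i j = twisted_laplacian X \<alpha> vs (unity_root n m) i j + (if m = 0 then of_nat n else 0)" for m i j
  have eigen: "(\<Sum>q<n. a p i q j * unity_root n m ^ q) = unity_root n m ^ p * B m i j"
    if mp: "m < n" "p < n" for m p i j
  proof -
    let ?z = "unity_root n m" and ?out = "{e \<in> arcs X. tail X e = vs ! i}"
    have zn: "?z ^ n = 1" by (rule unity_root_power_n[OF n])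
    have "(\<Sum>q<n. a p i q j * ?z ^ q) =
        (\<Sum>q<n. \<Sum>e\<in>?out. (of_bool (p = q \<and> i = j) -
           of_bool (head X e = vs ! j \<and> (int p + \<alpha> e) mod int n = int q)) * ?z ^ q) + (\<Sum>q<n. ?z ^ q)"
      by (simp only: a_def distrib_right sum.distrib sum_distrib_right mult_1_left)
    also have "(\<Sum>q<n. ?z ^ q) = ?z ^ p * (if m = 0 then of_nat n else 0)"
      using mp by (simp add: sum_powers_root_unity[OF zn] unity_root_eq_1_iff)
    also have "(\<Sum>q<n. \<Sum>e\<in>?out. (of_bool (p = q \<and> i = j) -
           of_bool (head X e = vs ! j \<and> (int p + \<alpha> e) mod int n = int q)) * ?z ^ q) =
        (\<Sum>e\<in>?out. \<Sum>q<n. (of_bool (p = q \<and> i = j) -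
           of_bool (head X e = vs ! j \<and> (int p + \<alpha> e) mod int n = int q)) * ?z ^ q)"
      by (rule sum.swap)
    also have "\<dots> = (\<Sum>e\<in>?out. ?z ^ p * (of_bool (i = j) - of_bool (head X e = vs ! j) * ?z powi \<alpha> e))"
    proof (rule sum.cong)
      fix e
      have z0: "?z \<noteq> 0" using norm_unity_root[of n m] by (metis norm_zero zero_neq_one)
      \<comment> \<open>The sheet in which the lift of \<open>e\<close> starting in sheet
        \<open>p\<close> ends.\<close>
      define t where "t = nat ((int p + \<alpha> e) mod int n)"
      have t: "t < n" "(int p + \<alpha> e) mod int n = int t" using n by (simp_all add: t_def nat_less_iff)
      have "(\<Sum>q<n. (of_bool (p = q \<and> i = j) -
           of_bool (head X e = vs ! j \<and> (int p + \<alpha> e) mod int n = int q)) * ?z ^ q) =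
         (\<Sum>q<n. if q = p then of_bool (i = j) * ?z ^ p else 0) -
         (\<Sum>q<n. if q = t then of_bool (head X e = vs ! j) * ?z ^ t else 0)"
        unfolding sum_subtractf[symmetric] t(2) by (rule sum.cong) auto
      also have "\<dots> = of_bool (i = j) * ?z ^ p - of_bool (head X e = vs ! j) * ?z ^ t"
        using mp t(1) by simp
      also have "?z ^ t = ?z ^ p * ?z powi \<alpha> e"
        using z0 unfolding t_def by (simp add: root_of_unity_power_nat_mod[OF zn n] power_int_add)
      finally show "(\<Sum>q<n. (of_bool (p = q \<and> i = j) -
           of_bool (head X e = vs ! j \<and> (int p + \<alpha> e) mod int n = int q)) * ?z ^ q) =
         ?z ^ p * (of_bool (i = j) - of_bool (head X e = vs ! j) * ?z powi \<alpha> e)"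
        by (simp add: algebra_simps)
    qed simp
    finally show ?thesis
      by (simp add: B_def twisted_laplacian_def sum_distrib_left distrib_left)
  qed
  have "of_nat (n * g) ^ 2 * of_nat (num_spanning_trees ?D ?r) =
      Determinant.det (mat (n * g) (n * g) (\<lambda>(k, l). laplacian ?D ws k l + 1) :: complex mat)"
    using matrix_tree[OF D finD ws(1-3), of "1 :: complex"] ws(4) by simp
  also have "mat (n * g) (n * g) (\<lambda>(k, l). laplacian ?D ws k l + 1) =
      mat (n * g) (n * g) (\<lambda>(k, l). a (k div g) (k mod g) (l div g) (l mod g))"
    by (rule cong_mat) (simp_all add: ws_def g_def a_def laplacian_derived_graph[OF X(2) n])
  also have "Determinant.det \<dots> = (\<Prod>m<n. Determinant.det (mat g g (\<lambda>(i, j). B m i j)))"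
    using eigen by (rule det_fourier)
  also have "\<dots> = Determinant.det (mat g g (\<lambda>(i, j). B 0 i j)) *
      (\<Prod>m\<in>{..<n} - {0}. Determinant.det (mat g g (\<lambda>(i, j). B m i j)))"
    using n by (intro prod.remove) auto
  also have "mat g g (\<lambda>(i, j). B 0 i j) = mat g g (\<lambda>(i, j). laplacian X vs i j + of_nat n)"
    by (rule cong_mat) (simp_all add: B_def twisted_laplacian_1)
  also have "Determinant.det \<dots> = of_nat n * of_nat g ^ 2 * of_nat (num_spanning_trees X arev)"
    using matrix_tree[OF X vs, of "of_nat n :: complex"] by (simp add: g_def)
  also have "(\<Prod>m\<in>{..<n} - {0}. Determinant.det (mat g g (\<lambda>(i, j). B m i j))) =
      (\<Prod>m\<in>{1..<n}. Determinant.det (mat g g (\<lambda>(i, j). twisted_laplacian X \<alpha> vs (unity_root n m) i j)))"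
  proof (rule prod.cong)
    show "{..<n} - {0} = {1..<n}" by auto
    fix m assume "m \<in> {1..<n}"
    then show "Determinant.det (mat g g (\<lambda>(i, j). B m i j)) =
        Determinant.det (mat g g (\<lambda>(i, j). twisted_laplacian X \<alpha> vs (unity_root n m) i j))"
      by (simp add: B_def)
  qed
  \<comment> \<open>The cover contributes (n g)^2 and the base n g^2; cancelling the latter leaves
    the single factor n of the claim.\<close>
  finally have "(of_nat n * of_nat g ^ 2) * (of_nat n * of_nat (num_spanning_trees ?D ?r)) =
      (of_nat n * of_nat g ^ 2) * (of_nat (num_spanning_trees X arev) *
      (\<Prod>m\<in>{1..<n}. Determinant.det (mat g g (\<lambda>(i, j). twisted_laplacian X \<alpha> vs (unity_root n m) i j))))"
    by (simp add: power2_eq_square mult_ac)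
  then show ?thesis
    using n g by (simp add: g_def)
qed

subsection \<open>The Ihara polynomial on the unit circle\<close>

text \<open>
  \<open>F\<close> is a Laurent polynomial whose value at \<open>z\<close> is \<open>c\<close>. A relation is used because formal Laurent
  series cannot be evaluated; it determines \<open>c\<close> only when \<open>z \<noteq> 0\<close>.
\<close>

definition laurent_value :: "'a :: field_char_0 \<Rightarrow> int fls \<Rightarrow> 'a \<Rightarrow> bool" where
  "laurent_value z F c \<longleftrightarrow> (\<exists>p k. fls_X ^ k * F = fps_to_fls (fps_of_poly p) \<and>
     poly (map_poly of_int p) z = z ^ k * c)"

lemma laurent_valueI:
  "fls_X ^ k * F = fps_to_fls (fps_of_poly p) \<Longrightarrow> poly (map_poly of_int p) z = z ^ k * c \<Longrightarrow> laurent_value z F c"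
  by (auto simp: laurent_value_def)

lemma fps_to_fls_monom: "fps_to_fls (fps_of_poly (Polynomial.monom (1 :: int) k)) = fls_X ^ k"
  by (simp add: fps_of_poly_monom fps_to_fls_power)

lemma laurent_value_add:
  assumes "laurent_value z F c" "laurent_value z G d"
  shows "laurent_value z (F + G) (c + d)"
proof -
  from assms obtain p k q l where *: "fls_X ^ k * F = fps_to_fls (fps_of_poly p)"
    "poly (map_poly of_int p) z = z ^ k * c" "fls_X ^ l * G = fps_to_fls (fps_of_poly q)"
    "poly (map_poly of_int q) z = z ^ l * d"
    by (auto simp: laurent_value_def)
  show ?thesis
  proof (rule laurent_valueI)
    have "fls_X ^ (k + l) * (F + G) = fls_X ^ l * (fls_X ^ k * F) + fls_X ^ k * (fls_X ^ l * G)"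
      by (simp add: power_add algebra_simps)
    also have "\<dots> = fps_to_fls (fps_of_poly (Polynomial.monom 1 l * p + Polynomial.monom 1 k * q))"
      by (simp only: * fps_to_fls_monom fps_of_poly_add fps_of_poly_mult fls_times_fps_to_fls fps_to_fls_plus)
    finally show "fls_X ^ (k + l) * (F + G) = fps_to_fls (fps_of_poly (Polynomial.monom 1 l * p + Polynomial.monom 1 k * q))" .
    show "poly (map_poly of_int (Polynomial.monom 1 l * p + Polynomial.monom 1 k * q)) z = z ^ (k + l) * (c + d)"
      by (simp add: of_int_poly_hom.hom_add of_int_poly_hom.hom_mult of_int_hom.map_poly_hom_monom poly_monom * power_add algebra_simps)
  qed
qed

lemma laurent_value_mult:
  assumes "laurent_value z F c" "laurent_value z G d"
  shows "laurent_value z (F * G) (c * d)"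
proof -
  from assms obtain p k q l where *: "fls_X ^ k * F = fps_to_fls (fps_of_poly p)"
    "poly (map_poly of_int p) z = z ^ k * c" "fls_X ^ l * G = fps_to_fls (fps_of_poly q)"
    "poly (map_poly of_int q) z = z ^ l * d"
    by (auto simp: laurent_value_def)
  show ?thesis
  proof (rule laurent_valueI)
    have "fls_X ^ (k + l) * (F * G) = (fls_X ^ k * F) * (fls_X ^ l * G)"
      by (simp add: power_add algebra_simps)
    then show "fls_X ^ (k + l) * (F * G) = fps_to_fls (fps_of_poly (p * q))"
      by (simp only: * fps_of_poly_mult fls_times_fps_to_fls)
    show "poly (map_poly of_int (p * q)) z = z ^ (k + l) * (c * d)"
      by (simp add: of_int_poly_hom.hom_mult * power_add algebra_simps)
  qed
qed

lemma laurent_value_of_int: "laurent_value z (of_int a) (of_int a)"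
  by (rule laurent_valueI[where k = 0 and p = "[:a:]"]) (simp_all add: fps_of_poly_const fls_of_int of_int_hom.map_poly_pCons_hom)

lemma laurent_value_X_intpow:
  assumes "z \<noteq> 0"
  shows "laurent_value z (fls_X_intpow a) (z powi a)"
proof (rule laurent_valueI)
  have X: "fls_X ^ k = (fls_X_intpow (int k) :: int fls)" for k
    by (rule fls_X_power_conv_shift_1)
  show "fls_X ^ nat (- a) * fls_X_intpow a = fps_to_fls (fps_of_poly (Polynomial.monom (1 :: int) (nat a)))"
  proof -
    have "int (nat (- a)) + a = int (nat a)" by simp
    then show ?thesis
      unfolding fps_to_fls_monom X fls_X_intpow_times_fls_X_intpow by (simp only:)
  qed
  have "z ^ nat a = z ^ nat (- a) * z powi a"
    using assms by (simp add: power_int_def field_simps)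
  then show "poly (map_poly of_int (Polynomial.monom 1 (nat a))) z = z ^ nat (- a) * z powi a"
    by (simp add: of_int_hom.map_poly_hom_monom poly_monom)
qed

lemma laurent_value_sum:
  "(\<And>x. x \<in> A \<Longrightarrow> laurent_value z (F x) (f x)) \<Longrightarrow> laurent_value z (sum F A) (sum f A)"
proof (induction A rule: infinite_finite_induct)
  case (insert x A)
  then show ?case by (simp add: laurent_value_add)
qed (use laurent_value_of_int[of z 0] in simp_all)

lemma laurent_value_prod:
  "(\<And>x. x \<in> A \<Longrightarrow> laurent_value z (F x) (f x)) \<Longrightarrow> laurent_value z (prod F A) (prod f A)"
proof (induction A rule: infinite_finite_induct)
  case (insert x A)
  then show ?case by (simp add: laurent_value_mult)
qed (use laurent_value_of_int[of z 1] in simp_all)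

text \<open>The Leibniz formula uses only integers, sums and products, under which
  \<open>laurent_value\<close> is closed; this replaces an evaluation homomorphism.\<close>

lemma laurent_value_det:
  assumes "A \<in> carrier_mat n n" "B \<in> carrier_mat n n"
    and "\<And>i j. i < n \<Longrightarrow> j < n \<Longrightarrow> laurent_value z (A $$ (i, j)) (B $$ (i, j))"
  shows "laurent_value z (Determinant.det A) (Determinant.det B)"
  unfolding det_def'[OF assms(1)] det_def'[OF assms(2)]
proof (intro laurent_value_sum laurent_value_mult laurent_value_prod)
  fix p i assume "p \<in> {p. p permutes {0..<n}}" "i \<in> {0..<n}"
  then show "laurent_value z (A $$ (i, p i)) (B $$ (i, p i))"
    using assms(3)[of i "p i"] permutes_in_image[of p "{0..<n}" i] by auto
qed (rule laurent_value_of_int)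

lemma laurent_value_Ihara:
  fixes z :: "'a :: field_char_0"
  assumes "finite (arcs X)" "z \<noteq> 0"
  shows "laurent_value z (Ihara vs X \<alpha>)
    (Determinant.det (mat (length vs) (length vs) (\<lambda>(i, j). twisted_laplacian X \<alpha> vs z i j)))"
  unfolding Ihara_def
proof (rule laurent_value_det)
  fix i j assume ij: "i < length vs" "j < length vs"
  let ?out = "{e \<in> arcs X. tail X e = vs ! i}" and ?E = "{e \<in> arcs X. tail X e = vs ! i \<and> head X e = vs ! j}"
  have E: "?E = ?out \<inter> {e. head X e = vs ! j}" by auto
  have lval: "laurent_value z
      (of_int (if i = j then int (card ?out) else 0) + of_int (- 1) * (\<Sum>e\<in>?E. fls_X_intpow (\<alpha> e)))
      (of_int (if i = j then int (card ?out) else 0) + of_int (- 1) * (\<Sum>e\<in>?E. z powi \<alpha> e))"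
    by (intro laurent_value_add laurent_value_mult laurent_value_of_int laurent_value_sum laurent_value_X_intpow assms(2))
  show "laurent_value z ((degree_matrix vs X - voltage_adjacency_matrix vs X \<alpha>) $$ (i, j))
    (mat (length vs) (length vs) (\<lambda>(i, j). twisted_laplacian X \<alpha> vs z i j) $$ (i, j))"
  proof -
    have "finite ?out" using assms(1) by simp
    then have "twisted_laplacian X \<alpha> vs z i j =
        of_int (if i = j then int (card ?out) else 0) + of_int (- 1) * (\<Sum>e\<in>?E. z powi \<alpha> e)"
      unfolding twisted_laplacian_def E sum_subtractf by (simp add: sum.inter_restrict of_bool_def if_distrib if_distribR cong: if_cong)
    then show ?thesis
      using lval ij by (cases "i = j") (simp_all add: degree_matrix_def voltage_adjacency_matrix_def)
  qed
qed (auto simp: degree_matrix_def voltage_adjacency_matrix_def intro!: minus_carrier_mat)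

text \<open>The premise serves to say that the series is a Laurent polynomial. Dividing the
  polynomial it provides by the right power of t gives existence, and injectivity of the embedding
  gives uniqueness, so \<open>THE\<close> is well defined.\<close>

lemma Ihara_poly_eq:
  assumes "laurent_value z (Ihara vs X \<alpha>) c"
  shows "fps_to_fls (fps_of_poly (Ihara_poly vs X \<alpha>)) = fls_X_intpow (- fls_subdegree (Ihara vs X \<alpha>)) * Ihara vs X \<alpha>"
proof -
  define F where "F = Ihara vs X \<alpha>"
  from assms obtain p k where p: "fls_X ^ k * F = fps_to_fls (fps_of_poly p)"
    by (auto simp: laurent_value_def F_def)
  have X: "fls_X ^ k = (fls_X_intpow (int k) :: int fls)" by (rule fls_X_power_conv_shift_1)
  have coeff_p: "Polynomial.coeff p i = fls_nth F (int i - int k)" for i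
  proof -
    have "Polynomial.coeff p i = fls_nth (fps_to_fls (fps_of_poly p)) (int i)" by simp
    also have "\<dots> = fls_nth F (int i - int k)"
      unfolding p[symmetric] X fls_X_intpow_times_conv_shift by simp
    finally show ?thesis .
  qed
  have "\<exists>I. fps_to_fls (fps_of_poly I) = fls_X_intpow (- fls_subdegree F) * F"
  proof (cases "F = 0")
    case True then show ?thesis by (intro exI[of _ 0]) simp
  next
    case False
    have nonneg: "0 \<le> int k + fls_subdegree F"
    proof -
      have "fls_subdegree (fls_X ^ k * F) = int k + fls_subdegree F"
        using False by (simp add: X)
      then show ?thesis using fls_subdegree_fls_to_fps_gt0[of "fps_of_poly p"] p by simp
    qed
    \<comment> \<open>The order of vanishing of \<open>p\<close> at t = 0, so that
      \<open>poly_shift s\<close> divides exactly by the power of t in \<open>p\<close>.\<close>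
    define s where "s = nat (int k + fls_subdegree F)"
    show ?thesis
    proof (intro exI[of _ "poly_shift s p"] fls_eqI)
      fix n
      have "fls_nth (fls_X_intpow (- fls_subdegree F) * F) n = fls_nth F (n + fls_subdegree F)"
        unfolding fls_X_intpow_times_conv_shift by simp
      then show "fls_nth (fps_to_fls (fps_of_poly (poly_shift s p))) n = fls_nth (fls_X_intpow (- fls_subdegree F) * F) n"
        using nonneg by (auto simp: coeff_poly_shift coeff_p s_def)
    qed
  qed
  then have "\<exists>!I. fps_to_fls (fps_of_poly I) = fls_X_intpow (- fls_subdegree F) * F"
    by (metis fps_of_poly_eq_iff fps_to_fls_eq_iff)
  then show ?thesis
    unfolding Ihara_poly_def Let_def F_def[symmetric] by (rule theI')
qed

lemma norm_Ihara_poly: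
  fixes z :: complex
  assumes X: "finite (arcs X)" and z: "cmod z = 1"
  shows "cmod (poly (map_poly of_int (Ihara_poly vs X \<alpha>)) z) =
    cmod (Determinant.det (mat (length vs) (length vs) (\<lambda>(i, j). twisted_laplacian X \<alpha> vs z i j)))"
    (is "_ = cmod ?c")
proof -
  have z0: "z \<noteq> 0" using z by auto
  define F where "F = Ihara vs X \<alpha>"
  let ?I = "Ihara_poly vs X \<alpha>"
  have lval: "laurent_value z F ?c" unfolding F_def by (rule laurent_value_Ihara[OF X z0])
  then obtain p k where p: "fls_X ^ k * F = fps_to_fls (fps_of_poly p)"
    and pz: "poly (map_poly of_int p) z = z ^ k * ?c" by (auto simp: laurent_value_def)
  have I: "fps_to_fls (fps_of_poly ?I) = fls_X_intpow (- fls_subdegree F) * F"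
    using Ihara_poly_eq lval unfolding F_def by blast
  define b where "b = - fls_subdegree F"
  have X_pow: "fls_X ^ k = (fls_X_intpow (int k) :: int fls)" for k by (rule fls_X_power_conv_shift_1)
  \<comment> \<open>No sign of \<open>b\<close> is assumed, so both sides are multiplied by
    monomials that make all exponents natural. These have modulus 1 on the unit circle.\<close>
  have "fps_to_fls (fps_of_poly (Polynomial.monom 1 (k + nat (- b)) * ?I)) =
      fls_X_intpow (int (k + nat (- b)) + b) * F"
    unfolding fps_of_poly_mult fls_times_fps_to_fls fps_to_fls_monom X_pow I b_def[symmetric]
      fls_X_intpow_times_fls_X_intpow[symmetric] by (simp only: mult.assoc)
  also have "int (k + nat (- b)) + b = int (nat b) + int k" by simp
  also have "fls_X_intpow (int (nat b) + int k) * F = fps_to_fls (fps_of_poly (Polynomial.monom 1 (nat b) * p))"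
    unfolding fps_of_poly_mult fls_times_fps_to_fls fps_to_fls_monom X_pow p[symmetric]
      fls_X_intpow_times_fls_X_intpow[symmetric] by (simp only: mult.assoc)
  finally have "Polynomial.monom 1 (k + nat (- b)) * ?I = Polynomial.monom 1 (nat b) * p"
    by (simp only: fps_to_fls_eq_iff fps_of_poly_eq_iff)
  then have "poly (map_poly of_int (Polynomial.monom 1 (k + nat (- b)) * ?I)) z = poly (map_poly of_int (Polynomial.monom 1 (nat b) * p)) z"
    by simp
  then have "z ^ (k + nat (- b)) * poly (map_poly of_int ?I) z = z ^ nat b * (z ^ k * ?c)"
    by (simp add: of_int_poly_hom.hom_mult of_int_hom.map_poly_hom_monom poly_monom pz)
  then have "cmod (z ^ (k + nat (- b)) * poly (map_poly of_int ?I) z) = cmod (z ^ nat b * (z ^ k * ?c))"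
    by simp
  then show ?thesis using z by (simp add: norm_mult norm_power)
qed

subsection \<open>Asymptotics\<close>

lemma prod_unity_root_linear:
  assumes "0 < n"
  shows "(\<Prod>m<n. [:- unity_root n m, 1:]) = Polynomial.monom 1 n - 1"
proof (rule poly_eqI_degree_lead_coeff[where n = n and A = "unity_root n ` {..<n}"])
  let ?P = "\<Prod>m<n. [:- unity_root n m, 1:]"
  have deg: "degree ?P = n" by (subst degree_prod_eq_sum_degree) auto
  then show "degree ?P \<le> n" by simp
  have "lead_coeff ?P = 1" by (simp add: lead_coeff_prod)
  then show "Polynomial.coeff ?P n = Polynomial.coeff (Polynomial.monom 1 n - 1) n"
    using assms deg by simp
  show "n \<le> card (unity_root n ` {..<n})" by (simp add: card_image[OF inj_on_unity_root])
  show "degree (Polynomial.monom 1 n - 1 :: complex poly) \<le> n"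
    by (intro degree_diff_le) (simp_all add: degree_monom_le)
  fix z assume "z \<in> unity_root n ` {..<n}"
  then show "poly ?P z = poly (Polynomial.monom 1 n - 1) z"
    using assms by (auto simp: poly_prod poly_monom unity_root_power_n intro!: prod_zero)
qed

lemma prod_diff_unity_root:
  assumes "0 < n"
  shows "(\<Prod>m<n. z - unity_root n m) = z ^ n - 1"
  using arg_cong[OF prod_unity_root_linear[OF assms], of "\<lambda>p. poly p z"]
  by (simp add: poly_prod poly_monom)

text \<open>This is the value at 1 of (z^n - 1)/(z - 1) = 1 + z + ... + z^(n-1). The factor z - 1 is
  cancelled between polynomials, since it vanishes at the point of evaluation.\<close>

lemma prod_one_minus_unity_root:
  assumes "0 < n"
  shows "(\<Prod>m\<in>{1..<n}. 1 - unity_root n m) = of_nat n"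
proof -
  let ?Q = "\<Prod>m\<in>{1..<n}. [:- unity_root n m, 1:]" and ?R = "\<Sum>k<n. Polynomial.monom (1 :: complex) k"
  have "poly ([:- 1, 1:] * ?Q) z = poly ([:- 1, 1:] * ?R) z" for z
  proof -
    have "poly ([:- 1, 1:] * ?Q) z = (z - unity_root n 0) * (\<Prod>m\<in>{1..<n}. z - unity_root n m)"
      by (simp add: poly_prod left_diff_distrib)
    also have "\<dots> = (\<Prod>m<n. z - unity_root n m)"
      using assms by (subst prod.remove[of "{..<n}" 0]) (auto intro!: arg_cong2[of _ _ _ _ times] prod.cong)
    also have "\<dots> = poly ([:- 1, 1:] * ?R) z"
      by (simp add: prod_diff_unity_root[OF assms] poly_sum poly_monom power_diff_1_eq left_diff_distrib)
    finally show ?thesis .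
  qed
  then have "[:- 1, 1:] * ?Q = [:- 1, 1:] * ?R" by (intro poly_eq_poly_eq_iff[THEN iffD1] ext)
  then have "?Q = ?R" by (subst (asm) mult_left_cancel) simp_all
  then have "poly ?Q 1 = poly ?R 1" by simp
  then show ?thesis by (simp add: poly_prod poly_sum poly_monom)
qed

lemma of_int_poly_eq_prod_roots:
  "poly (map_poly of_int f) z = of_int (lead_coeff f) * (\<Prod>a\<leftarrow>complex_roots_int f. z - a)"
proof -
  have "poly (map_poly of_int f) z = poly (Polynomial.smult (of_int (lead_coeff f)) (\<Prod>a\<leftarrow>complex_roots_int f. [:- a, 1:])) z"
    by (simp only: complex_roots_int(1))
  then show ?thesis by (simp add: poly_prod_list o_def)
qed

text \<open>Both sides are the modulus of the resultant of \<open>f\<close> and t^n - 1, computed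
  from the roots of one or of the other; moduli absorb the signs.\<close>

lemma norm_pierce_lehmer:
  assumes "0 < n"
  shows "cmod (pierce_lehmer f n) = cmod (\<Prod>m<n. poly (map_poly of_int f) (unity_root n m))"
proof -
  have "cmod (\<Prod>m<n. \<Prod>a\<leftarrow>as. unity_root n m - a) = cmod (\<Prod>a\<leftarrow>as. a ^ n - 1)" for as
  proof (induction as)
    case (Cons a as)
    have "cmod (\<Prod>m<n. unity_root n m - a) = cmod (\<Prod>m<n. a - unity_root n m)"
      by (simp add: norm_minus_commute flip: prod_norm)
    then show ?case
      using Cons.IH by (simp add: prod.distrib norm_mult prod_diff_unity_root[OF assms])
  qed simp
  then show ?thesis
    by (simp add: pierce_lehmer_def of_int_poly_eq_prod_roots prod.distrib norm_mult norm_power)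
qed

text \<open>The full product of the values of \<open>C\<close> is \<Delta>_n(C) in modulus. The
  index 0 is left out here, and its factor C(1) has modulus |\<Delta>_1(C)|, whence the
  quotient.\<close>

lemma norm_prod_unity_root_mult:
  assumes n: "0 < n" and C: "poly (map_poly of_int C) (1 :: complex) \<noteq> 0"
  shows "cmod (\<Prod>m\<in>{1..<n}. poly (map_poly of_int ([:-1, 1:] ^ e * C)) (unity_root n m)) =
    real n ^ e * (cmod (pierce_lehmer C n) / cmod (pierce_lehmer C 1))"
proof -
  let ?C = "map_poly of_int C :: complex poly"
  have PL1: "cmod (pierce_lehmer C 1) = cmod (poly ?C 1)"
    by (simp add: norm_pierce_lehmer)
  have "cmod (pierce_lehmer C n) = cmod (poly ?C 1 * (\<Prod>m\<in>{1..<n}. poly ?C (unity_root n m)))"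
    unfolding norm_pierce_lehmer[OF n] using n
    by (subst prod.remove[of "{..<n}" 0]) (auto intro!: arg_cong[of _ _ cmod] arg_cong2[of _ _ _ _ times] prod.cong)
  then have "cmod (\<Prod>m\<in>{1..<n}. poly ?C (unity_root n m)) = cmod (pierce_lehmer C n) / cmod (pierce_lehmer C 1)"
    using C by (simp add: PL1[unfolded One_nat_def] norm_mult)
  moreover have "cmod (\<Prod>m\<in>{1..<n}. unity_root n m - 1) = real n"
  proof -
    have "cmod (\<Prod>m\<in>{1..<n}. unity_root n m - 1) = cmod (\<Prod>m\<in>{1..<n}. 1 - unity_root n m)"
      by (simp add: norm_minus_commute flip: prod_norm)
    then show ?thesis by (simp only: prod_one_minus_unity_root[OF n] norm_of_nat)
  qed
  moreover have "poly (map_poly of_int ([:-1, 1:] ^ e * C)) z = (z - 1) ^ e * poly ?C z" for z :: complex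
    by (simp add: of_int_poly_hom.hom_mult of_int_poly_hom.hom_power of_int_hom.map_poly_pCons_hom poly_power)
  ultimately show ?thesis
    by (simp add: prod.distrib norm_mult norm_power flip: prod_power_distrib)
qed

text \<open>Inside the unit disc a^n tends to 0; outside, the quotient is |1 - a^(-n)|. On the
  circle |a^n - 1| comes arbitrarily close to 0 infinitely often, so the limit fails there.\<close>

lemma tendsto_norm_power_minus_1:
  fixes a :: complex
  assumes "cmod a \<noteq> 1"
  shows "(\<lambda>n. cmod (a ^ n - 1) / max 1 (cmod a) ^ n) \<longlonglongrightarrow> 1"
proof (cases "cmod a < 1")
  case True
  have "(\<lambda>n. cmod (a ^ n - 1)) \<longlonglongrightarrow> cmod (0 - 1)"
    by (intro tendsto_intros LIMSEQ_power_zero True)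
  then show ?thesis using True by simp
next
  case False
  with assms have a: "1 < cmod a" by simp
  then have a0: "a \<noteq> 0" by auto
  have "cmod (inverse a) < 1" using a by (simp add: norm_inverse inverse_less_1_iff)
  then have "(\<lambda>n. cmod (1 - inverse a ^ n)) \<longlonglongrightarrow> cmod (1 - 0)"
    by (intro tendsto_intros LIMSEQ_power_zero)
  moreover have "cmod (1 - inverse a ^ n) = cmod (a ^ n - 1) / max 1 (cmod a) ^ n" for n
  proof -
    have "1 - inverse a ^ n = (a ^ n - 1) / a ^ n" using a0 by (simp add: field_simps)
    then show ?thesis using a by (simp add: norm_divide norm_power max_def)
  qed
  ultimately show ?thesis by simp
qed

lemma pierce_lehmer_asymp_equiv:
  assumes "\<forall>z. cmod z = 1 \<longrightarrow> poly (map_poly of_int f) z \<noteq> 0"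
  shows "(\<lambda>n. cmod (pierce_lehmer f n)) \<sim>[at_top] (\<lambda>n. mahler_measure f ^ n)"
proof (rule asymp_equivI')
  have f0: "f \<noteq> 0" using assms by (auto dest: spec[of _ 1])
  have roots: "cmod a \<noteq> 1" if "a \<in> set (complex_roots_int f)" for a
  proof
    assume "cmod a = 1"
    with assms have "poly (map_poly of_int f) a \<noteq> 0" by blast
    moreover have "poly (map_poly of_int f) a = 0"
      unfolding of_int_poly_eq_prod_roots using that by (auto simp: prod_list_zero_iff)
    ultimately show False by simp
  qed
  have lim: "(\<lambda>n. cmod (\<Prod>a\<leftarrow>as. a ^ n - 1) / (\<Prod>a\<leftarrow>as. max 1 (cmod a)) ^ n) \<longlonglongrightarrow> 1"
    if "\<And>a. a \<in> set as \<Longrightarrow> cmod a \<noteq> 1" for as :: "complex list"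
    using that
  proof (induction as)
    case (Cons a as)
    have "(\<lambda>n. (cmod (a ^ n - 1) / max 1 (cmod a) ^ n) *
        (cmod (\<Prod>a\<leftarrow>as. a ^ n - 1) / (\<Prod>a\<leftarrow>as. max 1 (cmod a)) ^ n)) \<longlonglongrightarrow> 1 * 1"
      using Cons by (intro tendsto_mult tendsto_norm_power_minus_1) auto
    then show ?case by (simp add: norm_mult power_mult_distrib)
  qed simp
  have mm: "mahler_measure f = cmod (of_int (lead_coeff f)) * (\<Prod>a\<leftarrow>complex_roots_int f. max 1 (cmod a))"
    by (simp add: mahler_measure_def mahler_measure_poly_def complex_roots_int_def)
  have "cmod (pierce_lehmer f n) / mahler_measure f ^ n =
      cmod (\<Prod>a\<leftarrow>complex_roots_int f. a ^ n - 1) / (\<Prod>a\<leftarrow>complex_roots_int f. max 1 (cmod a)) ^ n" for n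
    using f0 by (simp add: mm pierce_lehmer_def norm_mult norm_power power_mult_distrib)
  with lim[OF roots] show "(\<lambda>n. cmod (pierce_lehmer f n) / mahler_measure f ^ n) \<longlonglongrightarrow> 1" by simp
qed

text \<open>The root 1 contributes max(1, 1) = 1. Hence the growth rate may be stated with I
  although the limit is taken for J.\<close>

lemma mahler_measure_X_minus_1_power_mult:
  "mahler_measure ([:-1, 1:] ^ e * C) = mahler_measure C"
proof -
  have "mahler_measure_poly [:-1, 1:] = 1"
  proof -
    let ?as = "complex_roots_complex [:-1, 1:]"
    have "length ?as = Suc 0" by simp
    then obtain a where a: "?as = [a]" by (metis length_0_conv length_Suc_conv)
    then have "a = 1" using complex_roots(1)[of "[:-1, 1:]"] by simp
    with a show ?thesis by (simp add: mahler_measure_poly_def)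
  qed
  then have "mahler_measure_poly ([:-1, 1:] ^ e * D) = mahler_measure_poly D" for D
    by (induction e) (simp_all only: power_0 power_Suc mult.assoc measure_eq_prod mult_1_left)
  then show ?thesis
    by (simp add: mahler_measure_def of_int_poly_hom.hom_mult of_int_poly_hom.hom_power of_int_hom.map_poly_pCons_hom)
qed

lemma Ihara_poly_eq_cofactor:
  "Ihara_poly vs X \<alpha> = [:-1, 1:] ^ Ihara_order vs X \<alpha> * Ihara_cofactor vs X \<alpha>"
proof -
  let ?I = "Ihara_poly vs X \<alpha>" and ?e = "Ihara_order vs X \<alpha>"
  obtain J where J: "?I = [:-1, 1:] ^ ?e * J"
    using order_1[of 1 ?I] by (auto simp: Ihara_order_def)
  have "\<exists>!J. ?I = [:-1, 1:] ^ ?e * J"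
  proof (rule ex1I)
    show "?I = [:-1, 1:] ^ ?e * J" by (rule J)
    fix J' assume "?I = [:-1, 1:] ^ ?e * J'"
    with J have "[:-1, 1:] ^ ?e * J' = [:-1, 1:] ^ ?e * J" by simp
    then show "J' = J" by (subst (asm) mult_left_cancel) simp_all
  qed
  then show ?thesis unfolding Ihara_cofactor_def by (rule theI')
qed

theorem corollary3p10:
  fixes X :: "('v, 'e) pre_digraph" and arev :: "'e \<Rightarrow> 'e"
    and \<alpha> :: "'e \<Rightarrow> int" and vs :: "'v list"
  assumes "bidirected_digraph X arev"
    and "fin_digraph X"
    and "strongly_connected X"
    and "euler_char X \<noteq> 0"
    and "voltage_assignment integer_group X arev \<alpha>"
    and "strongly_connected (derived_graph integer_group X \<alpha>)"
    and "distinct vs" and "set vs = verts X"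
    and "\<forall>z :: complex. cmod z = 1 \<longrightarrow> poly (map_poly of_int (Ihara_cofactor vs X \<alpha>)) z \<noteq> 0"
  shows "(\<lambda>n. real (num_spanning_trees
              (derived_graph (integer_mod_group n) X (\<lambda>e. \<alpha> e mod int n))
              (derived_arev (integer_mod_group n) X arev (\<lambda>e. \<alpha> e mod int n))))
         \<sim>[at_top]
         (\<lambda>n. real n powi (int (Ihara_order vs X \<alpha>) - 1)
              * (real (num_spanning_trees X arev) / cmod (pierce_lehmer (Ihara_cofactor vs X \<alpha>) 1))
              * mahler_measure (Ihara_poly vs X \<alpha>) ^ n)"
proof -
  interpret X: fin_digraph X by fact
  define e where "e = Ihara_order vs X \<alpha>"
  define J where "J = Ihara_cofactor vs X \<alpha>"
  define \<kappa> where "\<kappa> n = num_spanning_trees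
              (derived_graph (integer_mod_group n) X (\<lambda>e. \<alpha> e mod int n))
              (derived_arev (integer_mod_group n) X arev (\<lambda>e. \<alpha> e mod int n))" for n
  have I: "Ihara_poly vs X \<alpha> = [:-1, 1:] ^ e * J"
    by (simp add: e_def J_def Ihara_poly_eq_cofactor)
  have J: "\<forall>z :: complex. cmod z = 1 \<longrightarrow> poly (map_poly of_int J) z \<noteq> 0"
    using assms(9) by (simp add: J_def)
  then have J1: "poly (map_poly of_int J) (1 :: complex) \<noteq> 0" by (metis norm_one)
  have vs: "vs \<noteq> []" using assms(3,8) by (auto simp: strongly_connected_def)
  have eq: "real n powi (int e - 1) * (real (num_spanning_trees X arev) / cmod (pierce_lehmer J 1)) *
      cmod (pierce_lehmer J n) = real (\<kappa> n)" if n: "0 < n" for n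
  proof -
    have "cmod (of_nat n * of_nat (\<kappa> n)) = cmod (of_nat (num_spanning_trees X arev) *
        (\<Prod>m\<in>{1..<n}. Determinant.det (mat (length vs) (length vs)
          (\<lambda>(i, j). twisted_laplacian X \<alpha> vs (unity_root n m) i j))))"
      using num_spanning_trees_cyclic_cover[OF assms(1,2) n assms(5,7,8) vs] by (simp only: \<kappa>_def)
    \<comment> \<open>Passing to moduli loses nothing, as the tree numbers are nonnegative, and lets
      the determinants be replaced by values of the Ihara polynomial on the unit circle.\<close>
    then have "real n * real (\<kappa> n) = real (num_spanning_trees X arev) *
        cmod (\<Prod>m\<in>{1..<n}. poly (map_poly of_int (Ihara_poly vs X \<alpha>)) (unity_root n m))"
      by (simp add: norm_mult norm_Ihara_poly flip: prod_norm)
    also have "\<dots> = real (num_spanning_trees X arev) *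
        (real n ^ e * (cmod (pierce_lehmer J n) / cmod (pierce_lehmer J 1)))"
      unfolding I by (simp only: norm_prod_unity_root_mult[OF n J1])
    finally have *: "real n * real (\<kappa> n) = real (num_spanning_trees X arev) *
        (real n ^ e * (cmod (pierce_lehmer J n) / cmod (pierce_lehmer J 1)))" .
    \<comment> \<open>The division by n is expressed with an integer exponent, so e = 0 needs no
      separate treatment.\<close>
    have "real (\<kappa> n) = real n * real (\<kappa> n) / real n" using n by simp
    also have "\<dots> = (real n ^ e / real n) *
        (real (num_spanning_trees X arev) / cmod (pierce_lehmer J 1)) * cmod (pierce_lehmer J n)"
      unfolding * by (simp add: divide_inverse mult_ac)
    also have "real n ^ e / real n = real n powi (int e - 1)"
      using n by (simp add: power_int_diff)
    finally show ?thesis by simp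
  qed
  have "(\<lambda>n. real n powi (int e - 1) * (real (num_spanning_trees X arev) / cmod (pierce_lehmer J 1)) *
        cmod (pierce_lehmer J n)) \<sim>[at_top]
      (\<lambda>n. real n powi (int e - 1) * (real (num_spanning_trees X arev) / cmod (pierce_lehmer J 1)) *
        mahler_measure J ^ n)"
    by (intro asymp_equiv_mult[OF asymp_equiv_refl] pierce_lehmer_asymp_equiv J)
  \<comment> \<open>The exact formula is available for n > 0; \<open>integer_mod_group 0\<close> is
    the infinite group of integers.\<close>
  moreover have "eventually (\<lambda>n. real n powi (int e - 1) *
      (real (num_spanning_trees X arev) / cmod (pierce_lehmer J 1)) * cmod (pierce_lehmer J n) = real (\<kappa> n)) at_top"
    using eventually_gt_at_top[of 0] by eventually_elim (rule eq)
  ultimately have "(\<lambda>n. real (\<kappa> n)) \<sim>[at_top]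
      (\<lambda>n. real n powi (int e - 1) * (real (num_spanning_trees X arev) / cmod (pierce_lehmer J 1)) *
        mahler_measure J ^ n)"
    by (rule asymp_equiv_transfer) simp
  moreover have "mahler_measure (Ihara_poly vs X \<alpha>) = mahler_measure J"
    by (simp only: I mahler_measure_X_minus_1_power_mult)
  ultimately show ?thesis by (simp only: \<kappa>_def e_def J_def)
qed

end
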